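(* For $N$ large and $N<N_2\le 2N$, set $H=\log^4 N$ and \[ S:=\sum_{0<h\le H}\left|\sum_{N<n\le N_2}\Lambda(n)\,e\big(h\operatorname{Li}(n)\big)\right|. \] Then for any $\varepsilon>0$, $S\ll_{\varepsilon} N^{21/22+\varepsilon}$ as $N\to\infty$ (uniformly in $N_2$).
   Context: $\Lambda$ is the von Mangoldt function ($\Lambda(n)=\log p$ if $n=p^k$ is a prime power, $0$ otherwise), $e(x)=e^{2\pi i x}$, $h$ ranges over integers, and $\operatorname{Li}(x)=\int_2^x\frac{dt}{\log t}$ is the logarithmic integral. *)

theory Defs
  imports "HOL-Analysis.Analysis" "HOL-Number_Theory.Prime_Powers"
begin

definition e :: "real \<Rightarrow> complex" where
  "e x = exp (2 * of_real pi * \<i> * of_real x)"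

(* For x < 2 the interval is empty and the value is 0. *)
definition Li :: "real \<Rightarrow> real" where
  "Li x = integral {2..x} (\<lambda>t. 1 / ln t)"

(* H = log^4 N denotes the fourth power of the natural logarithm.
   N and N2 are real parameters; n ranges over natural numbers and h over integers. *)
definition S :: "real \<Rightarrow> real \<Rightarrow> real" where
  "S N N2 =
     (\<Sum>h\<in>{h :: int. 0 < h \<and> of_int h \<le> (ln N) ^ 4}.
        norm (\<Sum>n\<in>{n :: nat. N < real n \<and> real n \<le> N2}.
          mangoldt n * e (of_int h * Li (real n))))"

end

theory Submission
  imports Defs "HOL-Computational_Algebra.Squarefree" "HOL-Real_Asymp.Real_Asymp"
begin

text \<open>
  Write \<open>N = w ^ 22\<close> and \<open>L = ln N\<close>. Since \<open>h Li(x)\<close> has second derivative of size \<open>1 / N\<close> up to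
  powers of \<open>L\<close>, van der Corput's second derivative test bounds the sum of \<open>e(h Li(r l))\<close> over
  \<open>N < r l \<le> N2\<close> by \<open>sqrt N\<close> up to powers of \<open>L\<close>, uniformly in \<open>r \<le> w ^ 8\<close>. Vaughan's identity with
  \<open>U = w ^ 6\<close> and \<open>V = w ^ 2\<close> therefore has type I contribution about \<open>U V sqrt N = w ^ 19\<close>.
  For the type II sum over \<open>m > U\<close>, \<open>k > V\<close>, apply Cauchy's inequality in \<open>m\<close>, with weight \<open>m\<close>, and a
  Weyl shift of length \<open>Q = V\<close> in \<open>k\<close>. The phase \<open>h (Li(m k) - Li(m l))\<close> in \<open>m\<close> has second derivative
  of size \<open>k (l - k) / N\<close> up to powers of \<open>L\<close>, so the second derivative test gives the bound
  \<open>N\<^sup>2 (1 / Q + sqrt (Q / U))\<close>, about \<open>N\<^sup>2 / w\<^sup>2\<close>, for the square of the type II sum.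
  The exponent \<open>21 / 22\<close> comes from \<open>N / w = w ^ 21\<close>.
\<close>

subsection \<open>Kusmin-Landau inequality and second derivative test\<close>

text \<open>The Moebius coefficients of the type II sum are bounded only by the divisor count d(m),
  so Cauchy's inequality needs the sum of d(m)^2 / m, which costs just powers of \<open>L\<close>.
  The same weight \<open>m\<close> absorbs the length N / m of the sum over \<open>k\<close>, so all
  m in U < m <= X are treated at once, without dyadic splitting. The windows in \<open>k\<close>
  after the shift are indexed by all t <= X, a range free of \<open>m\<close>, so the sum over
  \<open>m\<close> can be moved innermost, where it oscillates. The diagonal k = l costs 1 / Q and
  the rest sqrt (Q / U); equating them gives U = Q^3, hence \<open>w ^ 6\<close> against
  \<open>w ^ 2\<close>. The condition Q <= V < k <= 2 N / m keeps the shift comparable to the range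
  of \<open>k\<close>. Type I ends with \<open>w ^ 2\<close> to spare. The second derivative of
  \<open>Li\<close> is -1 / (x ln^2 x): one sign, and its extreme values on the range differ only by
  a constant factor, so the second derivative test loses no power of \<open>N\<close>.\<close>

lemma e_add: "e (x + y) = e x * e y"
  by (simp add: e_def exp_add[symmetric] algebra_simps)

lemma e_eq_cis: "e x = cis (2 * pi * x)"
  by (simp add: e_def cis_conv_exp mult_ac)

lemma norm_e [simp]: "norm (e x) = 1"
  by (simp add: e_eq_cis)

lemma e_of_int [simp]: "e (of_int k) = 1"
  by (simp add: e_eq_cis cis.ctr complex_eq_iff sin_int_2pin cos_int_2pin)

lemma cnj_e: "cnj (e x) = e (- x)"
  by (simp add: e_eq_cis cis_cnj)

lemma e_diff_of_int: "e (x - of_int k) = e x"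
  using e_add[of "x - of_int k" "of_int k"] by simp

text \<open>This is the closed form of 1 / (1 - e x). Its real part is the constant 1/2, so all its
  variation sits in a cotangent, which is monotone between consecutive poles.\<close>

lemma one_minus_e_times_cot:
  assumes "sin (pi * x) \<noteq> 0"
  shows "(1 + \<i> * complex_of_real (cot (pi * x))) / 2 * (1 - e x) = 1"
proof -
  let ?s = "sin (pi * x)" and ?c = "cos (pi * x)"
  have "2 * pi * x = 2 * (pi * x)" by simp
  hence e: "e x = Complex (1 - 2 * ?s\<^sup>2) (2 * ?s * ?c)"
    unfolding e_eq_cis by (simp only: cis.ctr cos_double_sin sin_double)
  have "?c * ?c * ?s = ?s - ?s * ?s * ?s"
    using sin_cos_squared_add3[of "pi * x"] by algebra
  thus ?thesis unfolding e cot_def using assms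
    by (simp add: complex_eq_iff field_simps power2_eq_square)
qed

text \<open>Jordan's inequality: the concave sine lies above its chord from 0 to pi / 2, and
  \<open>2 * x\<close> is the position along that chord.\<close>

lemma sin_pi_ge:
  assumes "0 \<le> x" "x \<le> 1 / 2"
  shows "2 * x \<le> sin (pi * x)"
proof -
  have "concave_on {0..pi} sin"
    by (rule f''_le0_imp_concave[where f' = cos and f'' = "\<lambda>x. - sin x"])
       (auto intro!: derivative_eq_intros sin_ge_zero)
  from concave_onD[OF this, of "2 * x" 0 "pi / 2"] assms show ?thesis
    by (simp add: algebra_simps)
qed

text \<open>Abel summation moves the differences from \<open>E\<close> to \<open>c\<close>, so only
  the end values and the total variation of \<open>c\<close> are paid for.\<close>

lemma sum_by_parts_norm_le:
  fixes c E :: "nat \<Rightarrow> complex"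
  assumes "u \<le> v" and E: "\<And>n. norm (E n) \<le> 1"
  shows "norm (\<Sum>n=u..v. c n * (E n - E (Suc n)))
           \<le> norm (c u) + norm (c v) + (\<Sum>n=u..<v. norm (c (Suc n) - c n))"
proof -
  have "(\<Sum>n=u..v. c n * (E n - E (Suc n)))
          = c u * E u - c v * E (Suc v) + (\<Sum>n=u..<v. (c (Suc n) - c n) * E (Suc n))"
    using \<open>u \<le> v\<close> by (induction v rule: dec_induct) (auto simp: algebra_simps)
  also have "norm \<dots> \<le> norm (c u * E u) + norm (c v * E (Suc v))
      + (\<Sum>n=u..<v. norm ((c (Suc n) - c n) * E (Suc n)))"
    by (intro order_trans[OF norm_triangle_ineq] add_mono norm_triangle_ineq4 norm_sum)
  also have "\<dots> \<le> norm (c u) + norm (c v) + (\<Sum>n=u..<v. norm (c (Suc n) - c n))"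
    by (intro add_mono sum_mono) (auto simp: norm_mult intro!: mult_left_le E)
  finally show ?thesis .
qed

lemma cot_antimono:
  assumes "0 < a" "a \<le> b" "b < pi"
  shows "cot b \<le> cot a"
proof -
  have "sin a > 0" "sin b > 0" "sin (b - a) \<ge> 0"
    using assms by (auto intro!: sin_gt_zero sin_ge_zero)
  moreover from this have "cot a - cot b = sin (b - a) / (sin a * sin b)"
    by (simp add: cot_def sin_diff field_simps)
  ultimately have "cot a - cot b \<ge> 0" by simp
  thus ?thesis by simp
qed

text \<open>Dividing by 1 - e (\<delta> n) writes each term as a multiple \<open>c n\<close> of a
  difference of consecutive values, and summation by parts applies. The two end values of
  \<open>c\<close> contribute 1 / (4 \<theta>) each and the variation of \<open>c\<close>
  contributes 1 / (2 \<theta>). The increment at \<open>v\<close> involves \<open>g (Suc v)\<close>,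
  one point beyond the sum.\<close>

theorem Kusmin_Landau:
  fixes g :: "nat \<Rightarrow> real" and k :: int
  defines "\<delta> \<equiv> \<lambda>n. g (Suc n) - g n"
  assumes "u \<le> v" "\<theta> > 0"
    and mono: "\<And>n. u \<le> n \<Longrightarrow> n < v \<Longrightarrow> \<delta> n \<le> \<delta> (Suc n)"
    and lower: "\<And>n. u \<le> n \<Longrightarrow> n \<le> v \<Longrightarrow> of_int k + \<theta> \<le> \<delta> n"
    and upper: "\<And>n. u \<le> n \<Longrightarrow> n \<le> v \<Longrightarrow> \<delta> n \<le> of_int k + 1 - \<theta>"
  shows "norm (\<Sum>n=u..v. e (g n)) \<le> 1 / \<theta>"
proof -
  define y where "y n = \<delta> n - of_int k" for n
  define c where "c n = (1 + \<i> * complex_of_real (cot (pi * y n))) / 2" for n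
  have y: "\<theta> \<le> y n" "y n \<le> 1 - \<theta>" if "u \<le> n" "n \<le> v" for n
    using lower[OF that] upper[OF that] by (auto simp: y_def)
  have sin: "sin (pi * y n) \<ge> 2 * \<theta>" if "u \<le> n" "n \<le> v" for n
  proof (cases "y n \<le> 1 / 2")
    case True
    thus ?thesis using sin_pi_ge[of "y n"] y[OF that] \<open>\<theta> > 0\<close> by auto
  next
    case False
    \<comment> \<open>Reflection at 1/2 brings the upper half of the range back to the interval
      where \<open>sin_pi_ge\<close> applies.\<close>
    have "sin (pi * y n) = sin (pi * (1 - y n))"
      by (simp add: algebra_simps)
    thus ?thesis using sin_pi_ge[of "1 - y n"] y[OF that] \<open>\<theta> > 0\<close> False by auto
  qed
  have eq: "e (g n) = c n * (e (g n) - e (g (Suc n)))" if "u \<le> n" "n \<le> v" for n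
  proof -
    have "g (Suc n) = g n + \<delta> n" by (simp add: \<delta>_def)
    hence "e (g n) - e (g (Suc n)) = e (g n) * (1 - e (y n))"
      by (simp add: y_def e_diff_of_int e_add algebra_simps)
    hence "c n * (e (g n) - e (g (Suc n))) = e (g n) * (c n * (1 - e (y n)))"
      by simp
    also have "c n * (1 - e (y n)) = 1"
      unfolding c_def using sin[OF that] \<open>\<theta> > 0\<close> by (intro one_minus_e_times_cot) auto
    finally show ?thesis by simp
  qed
  have cot_le: "\<bar>cot (pi * y n)\<bar> \<le> 1 / (2 * \<theta>)" if "u \<le> n" "n \<le> v" for n
  proof -
    have "\<bar>cot (pi * y n)\<bar> = \<bar>cos (pi * y n)\<bar> / sin (pi * y n)"
      using sin[OF that] \<open>\<theta> > 0\<close> by (simp add: cot_def abs_divide)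
    also have "\<dots> \<le> 1 / (2 * \<theta>)"
      using sin[OF that] \<open>\<theta> > 0\<close> by (intro frac_le) auto
    finally show ?thesis .
  qed
  have c_le: "norm (c n) \<le> 1 / (4 * \<theta>)" if "u \<le> n" "n \<le> v" for n
  proof -
    have s: "sin (pi * y n) > 0" using sin[OF that] \<open>\<theta> > 0\<close> by linarith
    have "(1 / 2)\<^sup>2 + (cot (pi * y n) / 2)\<^sup>2 = (1 / (2 * sin (pi * y n)))\<^sup>2"
      using s by (simp add: cot_def field_simps)
    hence "norm (c n) = 1 / (2 * sin (pi * y n))"
      using s unfolding c_def by (simp add: cmod_def)
    also have "\<dots> \<le> 1 / (2 * (2 * \<theta>))"
      using sin[OF that] \<open>\<theta> > 0\<close> by (intro frac_le) auto
    finally show ?thesis by simp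
  qed
  have "(\<Sum>n=u..v. e (g n)) = (\<Sum>n=u..v. c n * (e (g n) - e (g (Suc n))))"
    by (intro sum.cong eq) auto
  also have "norm \<dots> \<le> norm (c u) + norm (c v) + (\<Sum>n=u..<v. norm (c (Suc n) - c n))"
    using \<open>u \<le> v\<close> by (intro sum_by_parts_norm_le) auto
  \<comment> \<open>The real part of \<open>c\<close> is constant and the cotangent decreases along
    the increasing \<open>y\<close>, so every absolute difference equals a signed one and the
    variation telescopes.\<close>
  also have "(\<Sum>n=u..<v. norm (c (Suc n) - c n))
      = (\<Sum>n=u..<v. - cot (pi * y (Suc n)) / 2 - (- cot (pi * y n) / 2))"
  proof (intro sum.cong refl)
    fix n assume n: "n \<in> {u..<v}"
    have "cot (pi * y (Suc n)) \<le> cot (pi * y n)"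
    proof (rule cot_antimono)
      show "0 < pi * y n" using y[of n] n \<open>\<theta> > 0\<close> by auto
      show "pi * y n \<le> pi * y (Suc n)" using mono[of n] n by (auto simp: y_def)
      have "y (Suc n) < 1" using y[of "Suc n"] n \<open>\<theta> > 0\<close> by auto
      thus "pi * y (Suc n) < pi" by simp
    qed
    moreover have "c (Suc n) - c n = \<i> * complex_of_real ((cot (pi * y (Suc n)) - cot (pi * y n)) / 2)"
      by (simp add: c_def field_simps)
    ultimately show "norm (c (Suc n) - c n) = - cot (pi * y (Suc n)) / 2 - (- cot (pi * y n) / 2)"
      by (simp only: norm_mult norm_of_real) simp
  qed
  also have "\<dots> = cot (pi * y u) / 2 - cot (pi * y v) / 2"
    using \<open>u \<le> v\<close> by (subst sum_Suc_diff') auto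
  also have "\<dots> \<le> 1 / (2 * \<theta>)"
    using cot_le[of u] cot_le[of v] \<open>u \<le> v\<close> by (simp add: abs_le_iff)
  also have "norm (c u) + norm (c v) + 1 / (2 * \<theta>) \<le> 1 / (4 * \<theta>) + 1 / (4 * \<theta>) + 1 / (2 * \<theta>)"
    using c_le[of u] c_le[of v] \<open>u \<le> v\<close> by auto
  also have "\<dots> = 1 / \<theta>" using \<open>\<theta> > 0\<close> by (simp add: field_simps)
  finally show ?thesis by simp
qed

text \<open>Since \<delta> climbs by at least \<mu> per step, the first and last index whose values
  share a window of width \<open>w\<close> are at most w / \<mu> apart. This is the trivial count
  for indices with increments close to an integer.\<close>

lemma card_window_le:
  fixes \<delta> :: "nat \<Rightarrow> real"
  assumes "finite A" "\<mu> > 0" "w \<ge> 0"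
    and gap: "\<And>m n. m \<in> A \<Longrightarrow> n \<in> A \<Longrightarrow> m \<le> n \<Longrightarrow> \<mu> * real (n - m) \<le> \<delta> n - \<delta> m"
    and win: "\<And>n. n \<in> A \<Longrightarrow> c \<le> \<delta> n \<and> \<delta> n \<le> c + w"
  shows "real (card A) \<le> w / \<mu> + 1"
proof (cases "A = {}")
  case False
  let ?m = "Min A" and ?n = "Max A"
  have *: "?m \<in> A" "?n \<in> A" "?m \<le> ?n" using False \<open>finite A\<close> by auto
  have "card A \<le> card {?m..?n}"
    using \<open>finite A\<close> by (intro card_mono) auto
  hence "real (card A) \<le> real (?n - ?m) + 1" using *(3) by simp
  also have "\<mu> * real (?n - ?m) \<le> w"
    using gap[OF *] win[OF *(1)] win[OF *(2)] by linarith
  hence "real (?n - ?m) \<le> w / \<mu>" using \<open>\<mu> > 0\<close> by (simp add: field_simps)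
  finally show ?thesis by simp
qed (use assms in auto)

text \<open>Index sets cut out by monotone conditions such as N < r l <= N2 are handled through this
  property, so their endpoints never have to be computed; a finite nonempty one is the interval from
  its minimum to its maximum.\<close>

definition order_convex :: "'a :: order set \<Rightarrow> bool" where
  "order_convex A \<longleftrightarrow> (\<forall>x\<in>A. \<forall>z\<in>A. {x..z} \<subseteq> A)"

lemma order_convex_eq_atLeastAtMost:
  fixes A :: "'a :: linorder set"
  assumes "finite A" "A \<noteq> {}" "order_convex A"
  shows "A = {Min A..Max A}" "Min A \<in> A" "Max A \<in> A" "Min A \<le> Max A"
proof -
  show *: "Min A \<in> A" "Max A \<in> A" using assms(1,2) by auto
  thus "Min A \<le> Max A" using assms(1) by auto
  show "A = {Min A..Max A}" using assms(1,3) * unfolding order_convex_def by auto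
qed

text \<open>The indices are grouped by the integer part of the increasing \<delta>. In each group,
  those with \<delta> within \<theta> of an integer are counted trivially, and the middle ones form
  an interval to which \<open>Kusmin_Landau\<close> applies. The first factor bounds the number of
  groups, the second the cost of one.\<close>

theorem van_der_Corput_discrete:
  fixes g :: "nat \<Rightarrow> real"
  defines "\<delta> \<equiv> \<lambda>n. g (Suc n) - g n"
  assumes "\<mu> > 0"
    and lower: "\<And>n. u \<le> n \<Longrightarrow> Suc n < v \<Longrightarrow> \<mu> \<le> \<delta> (Suc n) - \<delta> n"
    and upper: "\<And>n. u \<le> n \<Longrightarrow> Suc n < v \<Longrightarrow> \<delta> (Suc n) - \<delta> n \<le> \<Lambda>"
    and "u < v" "\<Lambda> \<ge> 0"
  shows "norm (\<Sum>n=u..<v. e (g n)) \<le> (\<Lambda> * real (v - u) + 2) * (3 / sqrt \<mu> + 2)"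
proof -
  \<comment> \<open>This choice equates the trivial cost \<theta> / \<mu> near integers with the
    cost 1 / \<theta> of the middle range.\<close>
  define \<theta> where "\<theta> = sqrt \<mu>"
  have \<theta>: "\<theta> > 0" "\<theta> / \<mu> = 1 / sqrt \<mu>"
    using \<open>\<mu> > 0\<close> by (simp_all add: \<theta>_def field_simps)
  have gap: "\<mu> * real (n - m) \<le> \<delta> n - \<delta> m \<and> \<delta> n - \<delta> m \<le> \<Lambda> * real (n - m)"
    if "u \<le> m" "m \<le> n" "n < v" for m n
    using that(2,3)
  proof (induction n rule: dec_induct)
    case (step n)
    thus ?case using lower[of n] upper[of n] \<open>u \<le> m\<close>
      by (simp add: Suc_diff_le algebra_simps)
  qed auto
  have mono: "\<delta> m \<le> \<delta> n" if "u \<le> m" "m \<le> n" "n < v" for m n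
  proof -
    have "0 \<le> \<mu> * real (n - m)" using \<open>\<mu> > 0\<close> by simp
    thus ?thesis using gap[OF that] by linarith
  qed
  define K where "K = {\<lfloor>\<delta> u\<rfloor>..\<lfloor>\<delta> (v - 1)\<rfloor>}"
  define A where "A k = {n \<in> {u..<v}. \<lfloor>\<delta> n\<rfloor> = k}" for k
  have A_le: "norm (\<Sum>n\<in>A k. e (g n)) \<le> 3 / sqrt \<mu> + 2" for k
  proof -
    define B1 where "B1 = {n \<in> A k. \<delta> n < of_int k + \<theta>}"
    define B2 where "B2 = {n \<in> A k. of_int k + \<theta> \<le> \<delta> n \<and> \<delta> n \<le> of_int k + 1 - \<theta>}"
    \<comment> \<open>The first condition keeps \<open>B3\<close> disjoint from \<open>B1\<close>
      even when \<theta> > 1/2 makes the two windows overlap; \<open>B2\<close> is then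
      empty.\<close>
    define B3 where "B3 = {n \<in> A k. of_int k + \<theta> \<le> \<delta> n \<and> of_int k + 1 - \<theta> < \<delta> n}"
    have fin: "finite B1" "finite B2" "finite B3" by (auto simp: B1_def B2_def B3_def A_def)
    have card: "norm (\<Sum>n\<in>B. e (g n)) \<le> 1 / sqrt \<mu> + 1"
      if B: "B \<subseteq> {u..<v}" "\<And>n. n \<in> B \<Longrightarrow> c \<le> \<delta> n \<and> \<delta> n \<le> c + \<theta>" for B c
    proof -
      have "finite B" using B(1) finite_subset by blast
      hence "real (card B) \<le> \<theta> / \<mu> + 1"
        using B gap \<theta> \<open>\<mu> > 0\<close> by (intro card_window_le[of _ _ _ \<delta> c]) (auto simp: subset_iff)
      moreover have "norm (\<Sum>n\<in>B. e (g n)) \<le> real (card B)"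
        using norm_sum[of "\<lambda>n. e (g n)" B] by simp
      ultimately show ?thesis using \<theta>(2) by simp
    qed
    have "norm (\<Sum>n\<in>B1. e (g n)) \<le> 1 / sqrt \<mu> + 1"
      by (rule card[of _ "of_int k"]) (auto simp: B1_def A_def)
    moreover have "norm (\<Sum>n\<in>B3. e (g n)) \<le> 1 / sqrt \<mu> + 1"
    proof (rule card[of _ "of_int k + 1 - \<theta>"])
      fix n assume "n \<in> B3"
      thus "of_int k + 1 - \<theta> \<le> \<delta> n \<and> \<delta> n \<le> of_int k + 1 - \<theta> + \<theta>"
        unfolding B3_def A_def by auto
    qed (auto simp: B3_def A_def)
    moreover have "norm (\<Sum>n\<in>B2. e (g n)) \<le> 1 / sqrt \<mu>"
    proof (cases "B2 = {}")
      case False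
      \<comment> \<open>As \<theta> > 0, the two inequalities already determine the integer part;
        what remains is preserved between indices by monotonicity of \<delta>.\<close>
      have in_B2: "n \<in> B2 \<longleftrightarrow> u \<le> n \<and> n < v \<and> of_int k + \<theta> \<le> \<delta> n \<and> \<delta> n \<le> of_int k + 1 - \<theta>" for n
        using \<theta>(1) unfolding B2_def A_def by auto linarith
      have "order_convex B2"
        unfolding order_convex_def
      proof safe
        fix x y z assume "x \<in> B2" "z \<in> B2" "y \<in> {x..z}"
        thus "y \<in> B2" using mono[of x y] mono[of y z] unfolding in_B2 by auto
      qed
      note I = order_convex_eq_atLeastAtMost[OF fin(2) False this]
      have "norm (\<Sum>n=Min B2..Max B2. e (g n)) \<le> 1 / \<theta>"
      proof (rule Kusmin_Landau[where k = k])
        fix n assume "Min B2 \<le> n" "n \<le> Max B2"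
        hence "n \<in> B2" by (subst I(1)) simp
        thus "of_int k + \<theta> \<le> g (Suc n) - g n" "g (Suc n) - g n \<le> of_int k + 1 - \<theta>"
          unfolding in_B2 \<delta>_def by auto
      next
        fix n assume n: "Min B2 \<le> n" "n < Max B2"
        with I(2,3) have "u \<le> n" "Suc n < v" unfolding in_B2 by auto
        thus "g (Suc n) - g n \<le> g (Suc (Suc n)) - g (Suc n)"
          using mono[of n "Suc n"] by (simp add: \<delta>_def)
      qed (use \<theta> I(4) in auto)
      thus ?thesis using I(1) \<theta>_def by simp
    qed (use \<open>\<mu> > 0\<close> in auto)
    moreover have "(\<Sum>n\<in>A k. e (g n)) = (\<Sum>n\<in>B1. e (g n)) + (\<Sum>n\<in>B2. e (g n)) + (\<Sum>n\<in>B3. e (g n))"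
    proof -
      have "A k = (B1 \<union> B2) \<union> B3" by (auto simp: B1_def B2_def B3_def)
      moreover have "(B1 \<union> B2) \<inter> B3 = {}" "B1 \<inter> B2 = {}" by (auto simp: B1_def B2_def B3_def)
      ultimately show ?thesis using fin by (simp add: sum.union_disjoint)
    qed
    ultimately show ?thesis
      using norm_triangle_ineq[of "(\<Sum>n\<in>B1. e (g n)) + (\<Sum>n\<in>B2. e (g n))" "\<Sum>n\<in>B3. e (g n)"]
        norm_triangle_ineq[of "\<Sum>n\<in>B1. e (g n)" "\<Sum>n\<in>B2. e (g n)"] by simp
  qed
  have "(\<lambda>n. \<lfloor>\<delta> n\<rfloor>) ` {u..<v} \<subseteq> K"
    using \<open>u < v\<close> unfolding K_def by (auto intro!: floor_mono mono)
  hence "(\<Sum>n=u..<v. e (g n)) = (\<Sum>k\<in>K. \<Sum>n\<in>A k. e (g n))"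
    unfolding A_def by (subst sum.group) (auto simp: K_def)
  also have "norm \<dots> \<le> (\<Sum>k\<in>K. 3 / sqrt \<mu> + 2)"
    by (intro order_trans[OF norm_sum] sum_mono A_le)
  also have "\<dots> = real (card K) * (3 / sqrt \<mu> + 2)" by simp
  also have "real (card K) \<le> \<Lambda> * real (v - u) + 2"
  proof -
    have m: "\<delta> u \<le> \<delta> (v - 1)" using \<open>u < v\<close> by (intro mono) auto
    hence "\<lfloor>\<delta> u\<rfloor> \<le> \<lfloor>\<delta> (v - 1)\<rfloor>" by (rule floor_mono)
    hence "real (card K) = of_int (\<lfloor>\<delta> (v - 1)\<rfloor> - \<lfloor>\<delta> u\<rfloor> + 1)"
      unfolding K_def by simp
    also have "\<dots> \<le> \<delta> (v - 1) - \<delta> u + 2" by linarith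
    also have "\<delta> (v - 1) - \<delta> u \<le> \<Lambda> * real (v - 1 - u)" using gap[of u "v - 1"] \<open>u < v\<close> by auto
    also have "\<dots> \<le> \<Lambda> * real (v - u)" using \<open>\<Lambda> \<ge> 0\<close> by (intro mult_left_mono) auto
    finally show ?thesis by simp
  qed
  finally show ?thesis using \<open>\<mu> > 0\<close> by (simp add: mult_right_mono)
qed

text \<open>Second differences of \<open>g\<close> over unit steps are values of \<open>g''\<close>,
  by two uses of the mean value theorem. The bound \<mu> <= 1 lets every additive constant be
  absorbed into a multiple of 1 / sqrt \<mu>.\<close>

theorem van_der_Corput_second_derivative:
  fixes g g' g'' :: "real \<Rightarrow> real"
  assumes "0 < \<mu>" "\<mu> \<le> 1" "\<Lambda> \<ge> 0" "u \<le> v"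
    and g': "\<And>x. real u \<le> x \<Longrightarrow> x \<le> real v \<Longrightarrow> (g has_real_derivative g' x) (at x)"
    and g'': "\<And>x. real u \<le> x \<Longrightarrow> x \<le> real v \<Longrightarrow> (g' has_real_derivative g'' x) (at x)"
    and lower: "\<And>x. real u \<le> x \<Longrightarrow> x \<le> real v \<Longrightarrow> \<mu> \<le> g'' x"
    and upper: "\<And>x. real u \<le> x \<Longrightarrow> x \<le> real v \<Longrightarrow> g'' x \<le> \<Lambda>"
  shows "norm (\<Sum>n=u..v. e (g (real n))) \<le> 6 * (\<Lambda> * (real v - real u) + 2) / sqrt \<mu>"
proof -
  have one_le: "1 \<le> 1 / sqrt \<mu>" using assms(1,2) by simp
  show ?thesis
  proof (cases "u < v")
    case False
    hence [simp]: "v = u" using \<open>u \<le> v\<close> by simp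
    show ?thesis using one_le by simp
  next
    case True
    define d where "d n = g (real (Suc n)) - g (real n)" for n
    have second: "\<mu> \<le> d (Suc n) - d n \<and> d (Suc n) - d n \<le> \<Lambda>" if n: "u \<le> n" "Suc n < v" for n
    proof -
      have range: "real u \<le> real n" "real n + 2 \<le> real v" using n by linarith+
      \<comment> \<open>Applying the mean value theorem to the difference function g (x + 1) - g x,
        rather than to \<open>g\<close> twice, puts both values of \<open>g'\<close> exactly one
        unit apart.\<close>
      have "\<exists>z>real n. z < real n + 1 \<and>
              (g (real n + 1 + 1) - g (real n + 1)) - (g (real n + 1) - g (real n)) =
              (real n + 1 - real n) * (g' (z + 1) - g' z)"
        by (rule MVT2[where f = "\<lambda>x. g (x + 1) - g x"])
           (use range in \<open>auto intro!: derivative_intros g' DERIV_shift[THEN iffD1]\<close>)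
      then obtain z where z: "real n < z" "z < real n + 1" "d (Suc n) - d n = g' (z + 1) - g' z"
        by (auto simp: d_def algebra_simps)
      have "\<exists>w>z. w < z + 1 \<and> g' (z + 1) - g' z = (z + 1 - z) * g'' w"
        by (rule MVT2) (use z range in \<open>auto intro!: g''\<close>)
      then obtain w where w: "z < w" "w < z + 1" "g' (z + 1) - g' z = g'' w" by auto
      have "real u \<le> w" "w \<le> real v" using w z range by linarith+
      thus ?thesis using lower upper w(3) z(3) by simp
    qed
    have "norm (\<Sum>n=u..<v. e (g (real n))) \<le> (\<Lambda> * real (v - u) + 2) * (3 / sqrt \<mu> + 2)"
      using van_der_Corput_discrete[of \<mu> u v "\<lambda>n. g (real n)" \<Lambda>] second assms True
      unfolding d_def by auto
    \<comment> \<open>The last term is split off because its increment would need \<open>g\<close>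
      at v + 1, where nothing is assumed.\<close>
    moreover have "(\<Sum>n=u..v. e (g (real n))) = (\<Sum>n=u..<v. e (g (real n))) + e (g (real v))"
      using True by (simp add: sum.last_plus add.commute)
    ultimately have "norm (\<Sum>n=u..v. e (g (real n))) \<le> (\<Lambda> * real (v - u) + 2) * (3 / sqrt \<mu> + 2) + 1"
      using norm_triangle_ineq[of "\<Sum>n=u..<v. e (g (real n))" "e (g (real v))"] by simp
    also have "\<dots> \<le> (\<Lambda> * real (v - u) + 2) * (3 / sqrt \<mu> + 2) + (\<Lambda> * real (v - u) + 2) * 1"
      using \<open>\<Lambda> \<ge> 0\<close> by simp
    also have "\<dots> = (\<Lambda> * real (v - u) + 2) * (3 / sqrt \<mu> + 3 * 1)"
      by (simp add: algebra_simps)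
    also have "\<dots> \<le> (\<Lambda> * real (v - u) + 2) * (3 / sqrt \<mu> + 3 * (1 / sqrt \<mu>))"
      using one_le \<open>\<Lambda> \<ge> 0\<close> by (intro mult_left_mono add_left_mono) auto
    also have "\<dots> = 6 * (\<Lambda> * (real v - real u) + 2) / sqrt \<mu>"
      using True by (simp add: field_simps of_nat_diff)
    finally show ?thesis .
  qed
qed

subsection \<open>Exponential sums with phase built from Li\<close>

lemma Li_has_derivative:
  assumes "x > 2"
  shows "(Li has_real_derivative 1 / ln x) (at x)"
proof -
  have "continuous_on {2..x + 1} (\<lambda>t::real. 1 / ln t)"
    by (intro continuous_intros) auto
  from integral_has_real_derivative[OF this, of x]
  have "((\<lambda>x. integral {2..x} (\<lambda>t. 1 / ln t)) has_real_derivative 1 / ln x) (at x within {2..x + 1})"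
    using assms by simp
  moreover have "at x within {2..x + 1} = at x"
    using assms by (intro at_within_interior) auto
  moreover have "(\<lambda>x. integral {2..x} (\<lambda>t. 1 / ln t)) = Li"
    by (simp add: Li_def fun_eq_iff)
  ultimately show ?thesis by simp
qed

lemma Li_mult_has_derivative:
  assumes "r * x > 2"
  shows "((\<lambda>x. Li (r * x)) has_real_derivative r / ln (r * x)) (at x)"
  using DERIV_chain2[OF Li_has_derivative[OF assms] DERIV_cmult_Id[of r]] by simp

lemma inverse_ln_mult_has_derivative:
  assumes "r * x > 1"
  shows "((\<lambda>x. r / ln (r * x)) has_real_derivative - (r\<^sup>2 / (r * x * (ln (r * x))\<^sup>2))) (at x)"
proof -
  have "ln (r * x) > 0" "r * x \<noteq> 0" using assms by auto
  thus ?thesis using assms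
    by (auto intro!: derivative_eq_intros simp: field_simps power2_eq_square)
qed

lemma ln_bounds:
  fixes N x :: real
  assumes "N \<ge> 2" "N \<le> x" "x \<le> 2 * N"
  shows "ln N \<le> ln x" "ln x \<le> 2 * ln N"
proof -
  show "ln N \<le> ln x" using assms by simp
  have "ln x \<le> ln (N * N)"
    using assms by (intro ln_mono) (auto intro: order_trans[OF assms(3)] mult_right_mono)
  also have "\<dots> = 2 * ln N" using assms by (simp add: ln_mult)
  finally show "ln x \<le> 2 * ln N" .
qed

text \<open>The second derivative of the phase has size r^2 / N up to powers of \<open>L\<close> and
  the range of \<open>l\<close> has length at most N / r, so the factors \<open>r\<close> cancel and
  the bound is uniform in \<open>r\<close>. The condition r^2 <= N ensures \<mu> <= 1. Allowing any
  order convex \<open>A\<close> also covers the tails needed for partial summation.\<close>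

lemma norm_sum_e_Li_dilate_le:
  fixes N N2 :: real and h :: int and r :: nat and A :: "nat set"
  defines "L \<equiv> ln N"
  assumes N: "N \<ge> 2" "L \<ge> 1" "N2 \<le> 2 * N"
    and h: "0 < h" "of_int h \<le> L ^ 4"
    and r: "0 < r" "(real r)\<^sup>2 \<le> N"
    and A: "order_convex A" "A \<subseteq> {l. N < real (r * l) \<and> real (r * l) \<le> N2}"
  shows "norm (\<Sum>l\<in>A. e (of_int h * Li (real (r * l)))) \<le> 54 * L ^ 5 * sqrt N"
proof (cases "A = {}")
  case True
  thus ?thesis using N by simp
next
  case False
  have "A \<subseteq> {..nat \<lfloor>N2\<rfloor>}"
  proof
    fix l assume "l \<in> A"
    hence "real (r * l) \<le> N2" using A by auto
    moreover have "l \<le> r * l" using r by simp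
    hence "real l \<le> real (r * l)" by (rule of_nat_mono)
    ultimately show "l \<in> {..nat \<lfloor>N2\<rfloor>}" by (simp add: le_nat_iff le_floor_iff)
  qed
  hence "finite A" using finite_subset by blast
  define u v where "u = Min A" and "v = Max A"
  have uv: "A = {u..v}" "u \<in> A" "v \<in> A" "u \<le> v"
    using order_convex_eq_atLeastAtMost[OF \<open>finite A\<close> False A(1)] by (auto simp: u_def v_def)
  have u: "N < r * real u" and v: "r * real v \<le> 2 * N"
    using uv A N by auto
  define \<mu> where "\<mu> = (real r)\<^sup>2 / (8 * N * L\<^sup>2)"
  define \<Lambda> where "\<Lambda> = L ^ 4 * (real r)\<^sup>2 / N"
  define g'' where "g'' x = h * ((real r)\<^sup>2 / (r * x * (ln (r * x))\<^sup>2))" for x :: real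
  have "N > 0" "L > 0" using N by auto
  have L4: "L ^ 4 \<ge> 1" and L2: "L\<^sup>2 \<ge> 1" using N by (auto intro: one_le_power)
  have range: "N \<le> r * x \<and> r * x \<le> 2 * N" if "real u \<le> x" "x \<le> real v" for x :: real
  proof -
    have "real r * real u \<le> r * x" "r * x \<le> r * real v" using that by (auto intro: mult_left_mono)
    thus ?thesis using u v by linarith
  qed
  have g'': "\<mu> \<le> g'' x \<and> g'' x \<le> \<Lambda>" if x: "real u \<le> x" "x \<le> real v" for x :: real
  proof -
    note rx = range[OF x]
    note ln = ln_bounds[OF N(1) conjunct1[OF rx] conjunct2[OF rx], folded L_def]
    have sq: "L\<^sup>2 \<le> (ln (r * x))\<^sup>2" "(ln (r * x))\<^sup>2 \<le> (2 * L)\<^sup>2"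
      using power_mono[OF ln(1), of 2] power_mono[OF ln(2), of 2] ln \<open>L > 0\<close> by auto
    have "0 < ln (r * x)" "0 < r * x" using rx ln \<open>N > 0\<close> \<open>L > 0\<close> by linarith+
    hence pos: "0 < r * x * (ln (r * x))\<^sup>2" by (metis mult_pos_pos zero_less_power)
    have "1 * ((real r)\<^sup>2 / (2 * N * (2 * L)\<^sup>2)) \<le> h * ((real r)\<^sup>2 / (r * x * (ln (r * x))\<^sup>2))"
    proof (rule mult_mono[OF _ divide_left_mono])
      show "real r * x * (ln (real r * x))\<^sup>2 \<le> 2 * N * (2 * L)\<^sup>2"
        by (rule mult_mono) (use rx sq \<open>N > 0\<close> in auto)
      show "0 < 2 * N * (2 * L)\<^sup>2 * (real r * x * (ln (real r * x))\<^sup>2)"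
        by (rule mult_pos_pos[OF _ pos]) (use \<open>N > 0\<close> \<open>L > 0\<close> in auto)
      show "1 \<le> real_of_int h" using h by linarith
    qed (use \<open>N > 0\<close> h in auto)
    moreover have "1 * ((real r)\<^sup>2 / (2 * N * (2 * L)\<^sup>2)) = \<mu>"
      by (simp add: \<mu>_def power2_eq_square)
    moreover have "h * ((real r)\<^sup>2 / (r * x * (ln (r * x))\<^sup>2)) \<le> L ^ 4 * ((real r)\<^sup>2 / (N * 1))"
    proof (rule mult_mono[OF _ divide_left_mono])
      show "N * 1 \<le> r * x * (ln (r * x))\<^sup>2"
        by (rule mult_mono) (use rx sq L2 \<open>N > 0\<close> in auto)
      show "0 < r * x * (ln (r * x))\<^sup>2 * (N * 1)"
        by (rule mult_pos_pos[OF pos]) (use \<open>N > 0\<close> in auto)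
    qed (use h rx \<open>N > 0\<close> in auto)
    ultimately show ?thesis unfolding g''_def \<Lambda>_def by simp
  qed
  \<comment> \<open>\<open>Li\<close> is concave here, so the phase is negated to get a positive
    second derivative; complex conjugation undoes this without changing the norm.\<close>
  have "norm (\<Sum>n=u..v. e (- (h * Li (r * real n)))) \<le> 6 * (\<Lambda> * (real v - real u) + 2) / sqrt \<mu>"
  proof (rule van_der_Corput_second_derivative[where g' = "\<lambda>x. - (h * (r / ln (r * x)))" and g'' = g''])
    show "0 < \<mu>" using r \<open>N > 0\<close> \<open>L > 0\<close> by (simp add: \<mu>_def)
    have "1 * N \<le> (8 * L\<^sup>2) * N" using L2 \<open>N > 0\<close> by (intro mult_right_mono) auto
    hence "(real r)\<^sup>2 \<le> 8 * N * L\<^sup>2" using r by (simp add: mult_ac)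
    thus "\<mu> \<le> 1" using \<open>N > 0\<close> \<open>L > 0\<close> by (simp add: \<mu>_def)
    show "0 \<le> \<Lambda>" using \<open>N > 0\<close> \<open>L > 0\<close> by (simp add: \<Lambda>_def)
    fix x :: real assume x: "real u \<le> x" "x \<le> real v"
    have x2: "r * x > 2" using range[OF x] range[of u] u \<open>u \<le> v\<close> N x(1)
      by (smt (verit) mult_left_mono of_nat_0_le_iff)
    show "((\<lambda>x. - (h * Li (r * x))) has_real_derivative - (h * (r / ln (r * x)))) (at x)"
      using x2 by (intro DERIV_minus DERIV_cmult Li_mult_has_derivative) auto
    have "((\<lambda>x. - (h * (r / ln (r * x)))) has_real_derivative
             - (h * - ((real r)\<^sup>2 / (r * x * (ln (r * x))\<^sup>2)))) (at x)"
      using x2 by (intro DERIV_minus DERIV_cmult inverse_ln_mult_has_derivative) auto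
    thus "((\<lambda>x. - (h * (r / ln (r * x)))) has_real_derivative g'' x) (at x)"
      by (simp add: g''_def)
  qed (use g'' uv in auto)
  also have "(\<Sum>n=u..v. e (- (h * Li (r * real n)))) = cnj (\<Sum>l\<in>A. e (of_int h * Li (real (r * l))))"
    by (simp add: uv(1) cnj_e)
  also have "norm \<dots> = norm (\<Sum>l\<in>A. e (of_int h * Li (real (r * l))))" by (rule complex_mod_cnj)
  also have "6 * (\<Lambda> * (real v - real u) + 2) / sqrt \<mu> \<le> 6 * (3 * L ^ 4 * r) / sqrt \<mu>"
  proof (intro divide_right_mono mult_left_mono)
    have "\<Lambda> * (real v - real u) = L ^ 4 * r * (r * real v - r * real u) / N"
      by (simp add: \<Lambda>_def power2_eq_square algebra_simps)
    also have "\<dots> \<le> L ^ 4 * r * N / N"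
      using u v \<open>N > 0\<close> \<open>L > 0\<close> by (intro divide_right_mono mult_left_mono) auto
    also have "\<dots> = L ^ 4 * r" using \<open>N > 0\<close> by simp
    finally have "\<Lambda> * (real v - real u) \<le> L ^ 4 * r" .
    moreover have "1 * 1 \<le> L ^ 4 * real r" using L4 r by (intro mult_mono) auto
    ultimately show "\<Lambda> * (real v - real u) + 2 \<le> 3 * L ^ 4 * r" by linarith
  qed (use \<open>N > 0\<close> in \<open>auto simp: \<mu>_def\<close>)
  also have "sqrt \<mu> = r / (sqrt 8 * sqrt N * L)"
    using \<open>L > 0\<close> by (simp add: \<mu>_def real_sqrt_divide real_sqrt_mult)
  also have "6 * (3 * L ^ 4 * r) / (r / (sqrt 8 * sqrt N * L)) = sqrt 8 * (18 * L ^ 5 * sqrt N)"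
    using r \<open>N > 0\<close> \<open>L > 0\<close> by (simp add: field_simps eval_nat_numeral)
  also have "\<dots> \<le> 3 * (18 * L ^ 5 * sqrt N)"
    using \<open>N > 0\<close> \<open>L > 0\<close> by (intro mult_right_mono real_le_lsqrt) auto
  finally show ?thesis by simp
qed

section \<open>Phases that are differences of two dilates of \<open>Li\<close>\<close>

text \<open>Divided by \<open>x\<close>, this difference is the second derivative of Li (a x) - Li
  (b x). By the mean value theorem it is b - a times (1 - 2 / ln) / ln^2. A logarithm of at least 4
  makes the numerator at least 1/2, and ln <= 2 ln N supplies the remaining factor 4 of the
  8.\<close>

lemma div_ln_square_diff_bounds:
  fixes N a b x :: real
  assumes N: "N \<ge> 2" "ln N \<ge> 4" and "0 < x" "a \<le> b" "N \<le> a * x" "b * x \<le> 2 * N"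
  shows "(b - a) / (8 * (ln N)\<^sup>2) \<le> b / (ln (b * x))\<^sup>2 - a / (ln (a * x))\<^sup>2"
    and "b / (ln (b * x))\<^sup>2 - a / (ln (a * x))\<^sup>2 \<le> b - a"
proof -
  let ?L = "ln N"
  have *: "(b - a) / (8 * ?L\<^sup>2) \<le> b / (ln (b * x))\<^sup>2 - a / (ln (a * x))\<^sup>2 \<and>
           b / (ln (b * x))\<^sup>2 - a / (ln (a * x))\<^sup>2 \<le> b - a"
  proof (cases "a = b")
    case False
    hence "a < b" using assms by simp
    define d where "d y = (1 - 2 / ln (y * x)) / (ln (y * x))\<^sup>2" for y
    have rng: "N \<le> y * x \<and> y * x \<le> 2 * N" if "a \<le> y" "y \<le> b" for y
    proof -
      have "a * x \<le> y * x" "y * x \<le> b * x" using that assms by (auto intro: mult_right_mono)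
      thus ?thesis using assms by linarith
    qed
    have "\<exists>z>a. z < b \<and> b / (ln (b * x))\<^sup>2 - a / (ln (a * x))\<^sup>2 = (b - a) * d z"
    proof (rule MVT2[OF \<open>a < b\<close>])
      fix y assume "a \<le> y" "y \<le> b"
      note r = rng[OF this]
      have ln: "ln (y * x) \<ge> 4" using ln_bounds[OF N(1) r[THEN conjunct1] r[THEN conjunct2]] N by linarith
      hence ln_nz: "ln (y * x) \<noteq> 0" by linarith
      have "y * x > 0" using r N by linarith
      hence "y > 0" using assms by (simp add: zero_less_mult_iff)
      show "((\<lambda>y. y / (ln (y * x))\<^sup>2) has_real_derivative d y) (at y)"
        unfolding d_def using ln_nz \<open>y > 0\<close> \<open>x > 0\<close>
        by (auto intro!: derivative_eq_intros simp: field_simps eval_nat_numeral)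
    qed
    then obtain z where z: "a < z" "z < b"
      and eq: "b / (ln (b * x))\<^sup>2 - a / (ln (a * x))\<^sup>2 = (b - a) * d z" by auto
    let ?l = "ln (z * x)"
    note r = rng[of z]
    have l: "?L \<le> ?l" "?l \<le> 2 * ?L" using ln_bounds[OF N(1), of "z * x"] r z by auto
    have "?l \<ge> 4" using l N by linarith
    have "(1 / 2) / (2 * ?L)\<^sup>2 \<le> d z"
      unfolding d_def using l N \<open>?l \<ge> 4\<close>
      by (intro frac_le power_mono) (auto simp: field_simps)
    hence "1 / (8 * ?L\<^sup>2) \<le> d z" by (simp add: power2_eq_square)
    moreover have "d z \<le> 1 / 1"
      unfolding d_def using \<open>?l \<ge> 4\<close> by (intro frac_le one_le_power) auto
    ultimately show ?thesis unfolding eq using \<open>a < b\<close>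
      mult_left_mono[of "1 / (8 * ?L\<^sup>2)" "d z" "b - a"] mult_left_mono[of "d z" 1 "b - a"] by simp
  qed auto
  from * show "(b - a) / (8 * ?L\<^sup>2) \<le> b / (ln (b * x))\<^sup>2 - a / (ln (a * x))\<^sup>2"
    and "b / (ln (b * x))\<^sup>2 - a / (ln (a * x))\<^sup>2 \<le> b - a" by auto
qed

lemma norm_sum_e_Li_diff_le:
  fixes N N2 :: real and h :: int and a b :: nat and A :: "nat set"
  defines "L \<equiv> ln N"
  assumes N: "N \<ge> 2" "L \<ge> 4" "N2 \<le> 2 * N"
    and h: "0 < h" "of_int h \<le> L ^ 4"
    and ab: "0 < a" "a < b" "real (b - a) * real a \<le> N"
    and A: "order_convex A" "A \<subseteq> {m. N < real (m * a) \<and> real (m * b) \<le> N2}"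
  shows "norm (\<Sum>m\<in>A. e (of_int h * (Li (real (m * a)) - Li (real (m * b)))))
           \<le> 96 * L ^ 5 * sqrt (real (b - a) * N / real a)"
proof (cases "A = {}")
  case True
  thus ?thesis using N by simp
next
  case False
  define q where "q = real (b - a)"
  have q: "q \<ge> 1" "real b - real a = q" using ab by (auto simp: q_def of_nat_diff)
  have "A \<subseteq> {..nat \<lfloor>N2\<rfloor>}"
  proof
    fix l assume "l \<in> A"
    hence "real (l * b) \<le> N2" using A by auto
    moreover have "l \<le> l * b" using ab by simp
    hence "real l \<le> real (l * b)" by (rule of_nat_mono)
    ultimately show "l \<in> {..nat \<lfloor>N2\<rfloor>}" by (simp add: le_nat_iff le_floor_iff)
  qed
  hence "finite A" using finite_subset by blast
  define u v where "u = Min A" and "v = Max A"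
  have uv: "A = {u..v}" "u \<in> A" "v \<in> A" "u \<le> v"
    using order_convex_eq_atLeastAtMost[OF \<open>finite A\<close> False A(1)] by (auto simp: u_def v_def)
  have u: "N < a * real u" and v: "b * real v \<le> 2 * N"
    using uv A N by (auto simp: mult.commute)
  define \<mu> where "\<mu> = q * a / (16 * N * L\<^sup>2)"
  define \<Lambda> where "\<Lambda> = L ^ 4 * q * a / N"
  define G where "G r x = r\<^sup>2 / (r * x * (ln (r * x))\<^sup>2)" for r x :: real
  define g'' where "g'' x = h * (G b x - G a x)" for x :: real
  have "N > 0" "L > 0" using N by auto
  have L4: "L ^ 4 \<ge> 1" and L2: "L\<^sup>2 \<ge> 1" using N by (auto intro: one_le_power)
  have range: "N < a * x" "a * x \<le> b * x" "b * x \<le> 2 * N" "0 < x" if "real u \<le> x" "x \<le> real v" for x :: real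
  proof -
    have "real a * real u \<le> a * x" "b * x \<le> b * real v" using that by (auto intro: mult_left_mono)
    thus "N < a * x" "b * x \<le> 2 * N" using u v by auto
    hence "a * x > 0" using N by linarith
    thus "x > 0" using ab by (simp add: zero_less_mult_iff)
    thus "a * x \<le> b * x" using ab by auto
  qed
  have g'': "\<mu> \<le> g'' x \<and> g'' x \<le> \<Lambda>" if x: "real u \<le> x" "x \<le> real v" for x :: real
  proof -
    note rx = range[OF x]
    define D where "D = b / (ln (b * x))\<^sup>2 - a / (ln (a * x))\<^sup>2"
    have "q / (8 * L\<^sup>2) \<le> D" "D \<le> q"
      using div_ln_square_diff_bounds[of N x "real a" "real b"] rx N ab q
      by (auto simp: L_def D_def)
    have eq: "g'' x = h * (D * (1 / x))"
      using rx ab by (simp add: g''_def G_def D_def power2_eq_square field_simps)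
    have "a * x \<le> 2 * N" using rx by linarith
    hence "1 / x \<le> a / N" "a / (2 * N) \<le> 1 / x"
      using rx \<open>N > 0\<close> by (auto simp: field_simps)
    have D0: "D \<ge> 0" using \<open>q / (8 * L\<^sup>2) \<le> D\<close> q by (smt (verit) divide_nonneg_nonneg zero_le_power2)
    have "1 * (q / (8 * L\<^sup>2) * (a / (2 * N))) \<le> h * (D * (1 / x))"
      using \<open>q / (8 * L\<^sup>2) \<le> D\<close> \<open>a / (2 * N) \<le> 1 / x\<close> h D0 rx q \<open>N > 0\<close>
      by (intro mult_mono) auto
    moreover have "h * (D * (1 / x)) \<le> L ^ 4 * (q * (a / N))"
      using \<open>D \<le> q\<close> \<open>1 / x \<le> a / N\<close> h D0 rx q \<open>L > 0\<close>
      by (intro mult_mono) auto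
    ultimately show ?thesis unfolding eq \<mu>_def \<Lambda>_def by (simp add: mult_ac)
  qed
  have "norm (\<Sum>n=u..v. e (h * (Li (a * real n) - Li (b * real n)))) \<le> 6 * (\<Lambda> * (real v - real u) + 2) / sqrt \<mu>"
  proof (rule van_der_Corput_second_derivative[where g' = "\<lambda>x. h * (a / ln (a * x) - b / ln (b * x))" and g'' = g''])
    show "0 < \<mu>" using ab q \<open>N > 0\<close> \<open>L > 0\<close> by (simp add: \<mu>_def)
    have "1 * N \<le> (16 * L\<^sup>2) * N" using L2 \<open>N > 0\<close> by (intro mult_right_mono) auto
    hence "q * a \<le> 16 * N * L\<^sup>2" using ab by (simp add: mult_ac q_def)
    thus "\<mu> \<le> 1" using \<open>N > 0\<close> \<open>L > 0\<close> by (simp add: \<mu>_def)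
    show "0 \<le> \<Lambda>" using \<open>N > 0\<close> \<open>L > 0\<close> q by (simp add: \<Lambda>_def)
    fix x :: real assume x: "real u \<le> x" "x \<le> real v"
    have x2: "a * x > 2" "b * x > 2" using range[OF x] N by linarith+
    show "((\<lambda>x. h * (Li (a * x) - Li (b * x))) has_real_derivative h * (a / ln (a * x) - b / ln (b * x))) (at x)"
      using x2 by (intro DERIV_cmult DERIV_diff Li_mult_has_derivative) auto
    have "((\<lambda>x. h * (a / ln (a * x) - b / ln (b * x))) has_real_derivative h * (- G a x - - G b x)) (at x)"
      using x2 unfolding G_def by (intro DERIV_cmult DERIV_diff inverse_ln_mult_has_derivative) auto
    thus "((\<lambda>x. h * (a / ln (a * x) - b / ln (b * x))) has_real_derivative g'' x) (at x)"
      by (simp add: g''_def)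
  qed (use g'' uv in auto)
  also have "(\<Sum>n=u..v. e (h * (Li (a * real n) - Li (b * real n))))
      = (\<Sum>m\<in>A. e (of_int h * (Li (real (m * a)) - Li (real (m * b)))))"
    by (simp add: uv(1) mult.commute)
  also have "6 * (\<Lambda> * (real v - real u) + 2) / sqrt \<mu> \<le> 6 * (4 * L ^ 4 * q) / sqrt \<mu>"
  proof (intro divide_right_mono mult_left_mono)
    have "a * (real v - real u) \<le> a * real v" by (intro mult_left_mono) auto
    also have "\<dots> \<le> 2 * N" using range(2,3)[of v] uv by auto
    finally have *: "a * (real v - real u) \<le> 2 * N" .
    have "\<Lambda> * (real v - real u) = L ^ 4 * q * (a * (real v - real u)) / N"
      by (simp add: \<Lambda>_def)
    also have "\<dots> \<le> L ^ 4 * q * (2 * N) / N"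
      using * \<open>N > 0\<close> \<open>L > 0\<close> q by (intro divide_right_mono mult_left_mono) auto
    also have "\<dots> = 2 * (L ^ 4 * q)" using \<open>N > 0\<close> by simp
    finally have "\<Lambda> * (real v - real u) \<le> 2 * (L ^ 4 * q)" .
    moreover have "1 * 1 \<le> L ^ 4 * q" using L4 q by (intro mult_mono) auto
    ultimately show "\<Lambda> * (real v - real u) + 2 \<le> 4 * L ^ 4 * q" by linarith
  qed (use \<open>N > 0\<close> q in \<open>auto simp: \<mu>_def\<close>)
  also have "sqrt \<mu> = sqrt q * sqrt a / (4 * sqrt N * L)"
    using \<open>L > 0\<close> by (simp add: \<mu>_def real_sqrt_divide real_sqrt_mult)
  also have "6 * (4 * L ^ 4 * q) / (sqrt q * sqrt a / (4 * sqrt N * L)) = 96 * L ^ 5 * ((q / sqrt q) * sqrt N / sqrt a)"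
    using ab q \<open>N > 0\<close> \<open>L > 0\<close> by (simp add: field_simps eval_nat_numeral)
  also have "q / sqrt q = sqrt q" using q by (simp add: real_div_sqrt)
  also have "sqrt q * sqrt N / sqrt a = sqrt (q * N / a)" by (simp add: real_sqrt_divide real_sqrt_mult)
  finally show ?thesis by (simp add: q_def)
qed

subsection \<open>Vaughan's identity\<close>

definition moebius_mu :: "nat \<Rightarrow> real" where
  "moebius_mu n = (if squarefree n then (-1) ^ card (prime_factors n) else 0)"

lemma abs_moebius_mu_le_1: "\<bar>moebius_mu n\<bar> \<le> 1"
  by (simp add: moebius_mu_def)

lemma moebius_mu_1 [simp]: "moebius_mu (Suc 0) = 1"
  by (simp add: moebius_mu_def)

lemma moebius_mu_prime_mult:
  assumes "prime p" "\<not> p dvd d"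
  shows "moebius_mu (p * d) = - moebius_mu d"
proof (cases "squarefree d")
  case True
  hence "d \<noteq> 0" by (metis not_squarefree_0)
  have "p \<notin> prime_factors d" using assms by auto
  moreover have "prime_factors (p * d) = insert p (prime_factors d)"
    using assms \<open>d \<noteq> 0\<close> by (subst prime_factors_product) (auto simp: prime_factorization_prime)
  moreover have "squarefree (p * d)"
    using True assms by (intro squarefree_mult_coprime) (auto intro: squarefree_prime prime_imp_coprime)
  ultimately show ?thesis using True by (simp add: moebius_mu_def)
next
  case False
  hence "\<not> squarefree (p * d)" using squarefree_multD(2) by blast
  thus ?thesis using False by (simp add: moebius_mu_def)
qed

text \<open>For a prime \<open>p\<close> dividing \<open>n\<close>, the divisors prime to \<open>p\<close> cancel against their products
  by \<open>p\<close>, and all remaining divisors are divisible by \<open>p\<^sup>2\<close>.\<close>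
lemma sum_moebius_mu_divisors:
  assumes "n > 1"
  shows "(\<Sum>d | d dvd n. moebius_mu d) = 0"
proof -
  obtain p where p: "prime p" "p dvd n" using assms prime_factor_nat[of n] by auto
  define A where "A = {d. d dvd n \<and> \<not> p dvd d}"
  define B where "B = {d. d dvd n \<and> p dvd d}"
  have fin: "finite A" "finite B" using assms by (auto simp: A_def B_def)
  have sub: "(*) p ` A \<subseteq> B"
    using p by (auto simp: A_def B_def intro!: divides_mult prime_imp_coprime)
  have "(\<Sum>d\<in>B. moebius_mu d) = (\<Sum>d\<in>(*) p ` A. moebius_mu d)"
  proof (rule sum.mono_neutral_right[OF fin(2) sub], safe)
    fix d assume d: "d \<in> B" "d \<notin> (*) p ` A"
    then obtain k where k: "d = p * k" by (auto simp: B_def)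
    have "k dvd n" using d k by (auto simp: B_def dest: dvd_mult_right)
    hence "p dvd k" using d k by (auto simp: A_def)
    hence "p\<^sup>2 dvd d" by (auto simp: k power2_eq_square)
    hence "\<not> squarefree d" using p unfolding squarefree_def by (metis not_prime_unit)
    thus "moebius_mu d = 0" by (simp add: moebius_mu_def)
  qed
  also have "\<dots> = (\<Sum>d\<in>A. moebius_mu (p * d))"
    using p by (subst sum.reindex) (auto simp: inj_on_def prime_gt_0_nat)
  also have "\<dots> = - (\<Sum>d\<in>A. moebius_mu d)"
    using p by (simp add: moebius_mu_prime_mult A_def sum_negf)
  finally have "(\<Sum>d\<in>A. moebius_mu d) + (\<Sum>d\<in>B. moebius_mu d) = 0" by simp
  moreover have "{d. d dvd n} = A \<union> B" "A \<inter> B = {}" by (auto simp: A_def B_def)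
  ultimately show ?thesis using fin by (simp add: sum.union_disjoint)
qed

text \<open>After exchanging the sums, multiples are parametrised by n = d l, a bijection because
  \<open>d\<close> is nonzero.\<close>

lemma sum_divisors_swap:
  fixes F :: "nat \<Rightarrow> nat \<Rightarrow> 'a :: comm_monoid_add"
  assumes "finite A" "finite D" "0 \<notin> D"
  shows "(\<Sum>n\<in>A. \<Sum>d | d \<in> D \<and> d dvd n. F d n) = (\<Sum>d\<in>D. \<Sum>l | d * l \<in> A. F d (d * l))"
proof -
  have "(\<Sum>n\<in>A. \<Sum>d | d \<in> D \<and> d dvd n. F d n) = (\<Sum>d\<in>D. \<Sum>n | n \<in> A \<and> d dvd n. F d n)"
    by (rule sum.swap_restrict) (use assms in auto)
  also have "\<dots> = (\<Sum>d\<in>D. \<Sum>l | d * l \<in> A. F d (d * l))"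
  proof (rule sum.cong[OF refl])
    fix d assume "d \<in> D"
    hence "d > 0" using assms by (cases d) auto
    thus "(\<Sum>n | n \<in> A \<and> d dvd n. F d n) = (\<Sum>l | d * l \<in> A. F d (d * l))"
      by (intro sum.reindex_bij_witness[of _ "\<lambda>l. d * l" "\<lambda>n. n div d"]) auto
  qed
  finally show ?thesis .
qed

text \<open>This is the Moebius function cut at \<open>U\<close>, convolved with the constant 1: the
  coefficient of the variable \<open>m\<close> in the type II part of Vaughan's identity.\<close>

definition truncated_moebius_sum :: "nat \<Rightarrow> nat \<Rightarrow> real" where
  "truncated_moebius_sum U m = (\<Sum>d | d \<in> {1..U} \<and> d dvd m. moebius_mu d)"

lemma abs_truncated_moebius_sum_le:
  assumes "m > 0"
  shows "\<bar>truncated_moebius_sum U m\<bar> \<le> real (card {d. d dvd m})"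
proof -
  have "\<bar>truncated_moebius_sum U m\<bar> \<le> (\<Sum>d | d \<in> {1..U} \<and> d dvd m. 1)"
    unfolding truncated_moebius_sum_def
    by (intro order_trans[OF sum_abs] sum_mono abs_moebius_mu_le_1)
  also have "\<dots> \<le> real (card {d. d dvd m})"
    using assms by (auto intro!: card_mono)
  finally show ?thesis .
qed

lemma truncated_moebius_sum_eq:
  assumes "0 < m" "m \<le> U"
  shows "truncated_moebius_sum U m = (if m = 1 then 1 else 0)"
proof -
  have "{d. d \<in> {1..U} \<and> d dvd m} = {d. d dvd m}"
    using assms by (auto dest: dvd_imp_le intro: Nat.gr0I)
  thus ?thesis using sum_moebius_mu_divisors[of m] assms
    by (cases "m = 1") (auto simp: truncated_moebius_sum_def)
qed

lemma sum_mangoldt_codivisors: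
  assumes "n > 0"
  shows "(\<Sum>l | l dvd n. mangoldt (n div l)) = ln (real n)"
proof -
  have "(\<Sum>l | l dvd n. mangoldt (n div l) :: real) = (\<Sum>d | d dvd n. mangoldt d)"
    using assms by (intro sum.reindex_bij_witness[of _ "\<lambda>d. n div d" "\<lambda>d. n div d"]) auto
  thus ?thesis using mangoldt_sum[of n, where ?'a = real] assms by simp
qed

text \<open>Convolving \<open>truncated_moebius_sum U\<close>, which agrees with the unit of Dirichlet convolution
  up to \<open>U\<close>, with \<open>mangoldt\<close> gives the truncated Moebius function convolved with the logarithm.\<close>
lemma mangoldt_eq_truncated:
  assumes "n > 0" "U \<ge> 1"
  shows "mangoldt n = (\<Sum>d | d \<in> {1..U} \<and> d dvd n. moebius_mu d * ln (real (n div d)))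
           - (\<Sum>m | m dvd n \<and> U < m. truncated_moebius_sum U m * mangoldt (n div m))"
proof -
  let ?a = "truncated_moebius_sum U"
  have fin: "finite {m. m dvd n}" using assms by simp
  have "(\<Sum>m | m dvd n. ?a m * mangoldt (n div m))
        = (\<Sum>m\<in>{m. m dvd n}. \<Sum>d | d \<in> {1..U} \<and> d dvd m. moebius_mu d * mangoldt (n div m))"
    by (simp add: truncated_moebius_sum_def sum_distrib_right)
  also have "\<dots> = (\<Sum>d=1..U. \<Sum>l | d * l dvd n. moebius_mu d * mangoldt (n div (d * l)))"
    using fin by (subst sum_divisors_swap) auto
  also have "\<dots> = (\<Sum>d=1..U. if d dvd n then moebius_mu d * ln (real (n div d)) else 0)"
  proof (rule sum.cong[OF refl])
    fix d assume d: "d \<in> {1..U}"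
    show "(\<Sum>l | d * l dvd n. moebius_mu d * mangoldt (n div (d * l)))
        = (if d dvd n then moebius_mu d * ln (real (n div d)) else 0)"
    proof (cases "d dvd n")
      case True
      then obtain k where k: "n = d * k" by auto
      have "(\<Sum>l | l dvd k. mangoldt (k div l)) = ln (real k)"
        using k assms by (intro sum_mangoldt_codivisors) auto
      thus ?thesis using k d by (simp add: sum_distrib_left[symmetric])
    next
      case False
      hence "{l. d * l dvd n} = {}" by (auto dest: dvd_mult_left)
      thus ?thesis using False by simp
    qed
  qed
  also have "\<dots> = (\<Sum>d | d \<in> {1..U} \<and> d dvd n. moebius_mu d * ln (real (n div d)))"
    by (subst sum.inter_filter[symmetric]) auto
  finally have 1: "(\<Sum>m | m dvd n. ?a m * mangoldt (n div m)) = \<dots>" .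
  have "(\<Sum>m | m dvd n. ?a m * mangoldt (n div m)) =
      (\<Sum>m | m dvd n \<and> m \<le> U. ?a m * mangoldt (n div m)) + (\<Sum>m | m dvd n \<and> U < m. ?a m * mangoldt (n div m))"
    by (subst sum.union_disjoint[symmetric]) (use fin in \<open>auto intro!: sum.cong\<close>)
  moreover have "(\<Sum>m | m dvd n \<and> m \<le> U. ?a m * mangoldt (n div m))
      = (\<Sum>m\<in>{1}. ?a m * mangoldt (n div m))"
    using assms by (intro sum.mono_neutral_right) (auto simp: truncated_moebius_sum_eq dest: dvd_pos_nat)
  moreover have "\<dots> = mangoldt n" using assms by (simp add: truncated_moebius_sum_eq)
  ultimately show ?thesis using 1 by linarith
qed

text \<open>\<open>mangoldt_eq_truncated\<close> is summed against \<open>E\<close>, and the part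
  with m > U is split by its cofactor \<open>k\<close> at \<open>V\<close>. For k <= V the
  coefficient of \<open>m\<close> is opened again, leaving a smooth sum over \<open>l\<close>; for k
  > V both variables are long and the sum stays bilinear.\<close>

theorem Vaughan_identity:
  fixes E :: "nat \<Rightarrow> complex"
  assumes J: "J \<subseteq> {U * V<..X}" and "U \<ge> 1"
  shows "(\<Sum>n\<in>J. mangoldt n * E n) =
      (\<Sum>d=1..U. of_real (moebius_mu d) * (\<Sum>k | d * k \<in> J. of_real (ln (real k)) * E (d * k)))
    - (\<Sum>k=1..V. mangoldt k * (\<Sum>d=1..U. of_real (moebius_mu d) * (\<Sum>l | d * l * k \<in> J. E (d * l * k))))
    - (\<Sum>m\<in>{U<..X}. of_real (truncated_moebius_sum U m) * (\<Sum>k | V < k \<and> m * k \<in> J. mangoldt k * E (m * k)))"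
proof -
  let ?a = "truncated_moebius_sum U"
  have fJ: "finite J" using J finite_subset by blast
  have pos: "n > 0" if "n \<in> J" for n using that J by auto
  have fin_co: "finite {k. m * k \<in> J}" if "m > 0" for m
  proof (rule finite_subset[OF _ fJ[THEN finite_imageI[of _ "\<lambda>n. n div m"]]])
    show "{k. m * k \<in> J} \<subseteq> (\<lambda>n. n div m) ` J"
      using that by (auto intro!: image_eqI[of _ _ "m * _"])
  qed
  have "(\<Sum>n\<in>J. mangoldt n * E n) =
      (\<Sum>n\<in>J. (\<Sum>d | d \<in> {1..U} \<and> d dvd n. of_real (moebius_mu d * ln (real (n div d))) * E n)
        - (\<Sum>m | m \<in> {U<..X} \<and> m dvd n. of_real (?a m) * mangoldt (n div m) * E n))"
  proof (rule sum.cong[OF refl])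
    fix n assume n: "n \<in> J"
    have "n \<le> X" using n J by auto
    have eq: "{m. m dvd n \<and> U < m} = {m. m \<in> {U<..X} \<and> m dvd n}"
      using \<open>n \<le> X\<close> pos[OF n] by (auto dest: dvd_imp_le)
    have "(mangoldt n :: complex) = of_real (mangoldt n)" by simp
    also have "\<dots> = of_real (\<Sum>d | d \<in> {1..U} \<and> d dvd n. moebius_mu d * ln (real (n div d)))
        - of_real (\<Sum>m | m dvd n \<and> U < m. ?a m * mangoldt (n div m))"
      by (subst mangoldt_eq_truncated[OF pos[OF n] \<open>U \<ge> 1\<close>]) simp
    finally show "mangoldt n * E n = (\<Sum>d | d \<in> {1..U} \<and> d dvd n. of_real (moebius_mu d * ln (real (n div d))) * E n)
        - (\<Sum>m | m \<in> {U<..X} \<and> m dvd n. of_real (?a m) * mangoldt (n div m) * E n)"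
      unfolding eq by (simp add: sum_distrib_right left_diff_distrib)
  qed
  also have "\<dots> = (\<Sum>n\<in>J. \<Sum>d | d \<in> {1..U} \<and> d dvd n. of_real (moebius_mu d * ln (real (n div d))) * E n)
        - (\<Sum>n\<in>J. \<Sum>m | m \<in> {U<..X} \<and> m dvd n. of_real (?a m) * mangoldt (n div m) * E n)"
    by (rule sum_subtractf)
  also have "(\<Sum>n\<in>J. \<Sum>d | d \<in> {1..U} \<and> d dvd n. of_real (moebius_mu d * ln (real (n div d))) * E n)
    = (\<Sum>d=1..U. of_real (moebius_mu d) * (\<Sum>k | d * k \<in> J. of_real (ln (real k)) * E (d * k)))"
    using fJ by (subst sum_divisors_swap) (auto simp: sum_distrib_left mult_ac intro!: sum.cong)
  also have "(\<Sum>n\<in>J. \<Sum>m | m \<in> {U<..X} \<and> m dvd n. of_real (?a m) * mangoldt (n div m) * E n)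
    = (\<Sum>m\<in>{U<..X}. \<Sum>k | m * k \<in> J. of_real (?a m) * mangoldt k * E (m * k))"
    using fJ by (subst sum_divisors_swap) (auto intro!: sum.cong)
  also have "\<dots> = (\<Sum>m\<in>{U<..X}. (\<Sum>k | k \<in> {1..V} \<and> m * k \<in> J. of_real (?a m) * mangoldt k * E (m * k))
      + (\<Sum>k | V < k \<and> m * k \<in> J. of_real (?a m) * mangoldt k * E (m * k)))"
  proof (rule sum.cong[OF refl])
    fix m assume "m \<in> {U<..X}"
    hence fin: "finite {k. m * k \<in> J}" by (intro fin_co) auto
    have eq: "{k. m * k \<in> J} = {k. k \<in> {1..V} \<and> m * k \<in> J} \<union> {k. V < k \<and> m * k \<in> J}"
      using pos by (auto simp: Suc_le_eq) (metis less_irrefl mult_0_right not_gr_zero)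
    show "(\<Sum>k | m * k \<in> J. of_real (?a m) * mangoldt k * E (m * k)) =
      (\<Sum>k | k \<in> {1..V} \<and> m * k \<in> J. of_real (?a m) * mangoldt k * E (m * k))
      + (\<Sum>k | V < k \<and> m * k \<in> J. of_real (?a m) * mangoldt k * E (m * k))"
      by (subst eq, rule sum.union_disjoint) (use fin in auto)
  qed
  also have "\<dots> = (\<Sum>m\<in>{U<..X}. \<Sum>k | k \<in> {1..V} \<and> m * k \<in> J. of_real (?a m) * mangoldt k * E (m * k))
    + (\<Sum>m\<in>{U<..X}. of_real (?a m) * (\<Sum>k | V < k \<and> m * k \<in> J. mangoldt k * E (m * k)))"
    by (simp add: sum.distrib sum_distrib_left mult_ac)
  also have "(\<Sum>m\<in>{U<..X}. \<Sum>k | k \<in> {1..V} \<and> m * k \<in> J. of_real (?a m) * mangoldt k * E (m * k))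
    = (\<Sum>k=1..V. \<Sum>m | m \<in> {U<..X} \<and> m * k \<in> J. of_real (?a m) * mangoldt k * E (m * k))"
    by (rule sum.swap_restrict) auto
  also have "\<dots> = (\<Sum>k=1..V. mangoldt k * (\<Sum>d=1..U. of_real (moebius_mu d) * (\<Sum>l | d * l * k \<in> J. E (d * l * k))))"
  proof (rule sum.cong[OF refl])
    fix k assume k: "k \<in> {1..V}"
    \<comment> \<open>Here the lower bound U V < n on \<open>J\<close> enters: with k <= V it forces
      m > U, so the sum over \<open>m\<close> is complete and its coefficient can be expanded
      freely.\<close>
    have eq: "{m. m \<in> {U<..X} \<and> m * k \<in> J} = {m. m * k \<in> J}"
    proof safe
      fix m assume "m * k \<in> J"
      hence m: "U * V < m * k" "m * k \<le> X" using J by auto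
      have "m * k \<le> m * V" using k by simp
      hence "U < m" using m(1) by (metis leD le_trans mult_le_mono1 not_less)
      moreover have "m \<le> X" using k by (intro le_trans[OF _ m(2)]) simp
      ultimately show "m \<in> {U<..X}" by simp
    qed
    have fin: "finite {m. m * k \<in> J}" using fin_co[of k] k by (simp add: mult.commute)
    have "(\<Sum>m | m * k \<in> J. of_real (?a m) * mangoldt k * E (m * k))
      = (\<Sum>m\<in>{m. m * k \<in> J}. \<Sum>d | d \<in> {1..U} \<and> d dvd m. of_real (moebius_mu d) * mangoldt k * E (m * k))"
      by (simp add: truncated_moebius_sum_def sum_distrib_right)
    also have "\<dots> = (\<Sum>d=1..U. \<Sum>l | d * l * k \<in> J. of_real (moebius_mu d) * mangoldt k * E (d * l * k))"
      using fin by (subst sum_divisors_swap) auto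
    finally show "(\<Sum>m | m \<in> {U<..X} \<and> m * k \<in> J. of_real (?a m) * mangoldt k * E (m * k)) =
        mangoldt k * (\<Sum>d=1..U. of_real (moebius_mu d) * (\<Sum>l | d * l * k \<in> J. E (d * l * k)))"
      unfolding eq by (simp add: sum_distrib_left mult_ac)
  qed
  finally show ?thesis by simp
qed

subsection \<open>Weyl shift for bilinear sums\<close>

text \<open>Each element of \<open>P\<close> lies in exactly \<open>Q\<close> of the windows t, ...,
  t + Q - 1, and at most \<open>K\<close> windows meet \<open>P\<close>; Cauchy's inequality over
  these windows gives the bound. The sum on the right runs over all t <= X so that it has the same
  range for every \<open>P\<close>.\<close>

lemma Weyl_shift:
  fixes x :: "nat \<Rightarrow> complex"
  assumes "finite P" and range: "\<And>n. n \<in> P \<Longrightarrow> Q \<le> n \<and> n \<le> X"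
    and K: "\<And>a b. a \<in> P \<Longrightarrow> b \<in> P \<Longrightarrow> a \<le> b \<Longrightarrow> real (b - a) + real Q \<le> K"
  shows "(real Q * norm (\<Sum>n\<in>P. x n))\<^sup>2
           \<le> K * (\<Sum>t\<le>X. (norm (\<Sum>j | j < Q \<and> t + j \<in> P. x (t + j)))\<^sup>2)"
proof (cases "P = {} \<or> Q = 0")
  case True
  thus ?thesis by auto
next
  case False
  hence "P \<noteq> {}" "Q > 0" by auto
  \<comment> \<open>The starts of the windows that can meet \<open>P\<close>. As Q <= Min P, the
    subtraction on naturals is a true one.\<close>
  define \<tau> where "\<tau> = {Suc (Min P) - Q..Max P}"
  have P: "Min P \<in> P" "Max P \<in> P" "\<And>n. n \<in> P \<Longrightarrow> Min P \<le> n \<and> n \<le> Max P" "Min P \<le> Max P"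
    using \<open>P \<noteq> {}\<close> \<open>finite P\<close> by auto
  have "Q \<le> Min P" "Max P \<le> X" using range P by auto
  have card: "real (card \<tau>) \<le> K"
  proof -
    have "card \<tau> = Max P - Min P + Q"
      using \<open>Q > 0\<close> \<open>Q \<le> Min P\<close> P(4) by (simp add: \<tau>_def)
    thus ?thesis using K[OF P(1,2,4)] by simp
  qed
  have "of_nat Q * (\<Sum>n\<in>P. x n) = (\<Sum>j<Q. \<Sum>n\<in>P. x n)" by simp
  also have "\<dots> = (\<Sum>j<Q. \<Sum>t | t \<in> \<tau> \<and> t + j \<in> P. x (t + j))"
  proof (rule sum.cong[OF refl])
    fix j assume j: "j \<in> {..<Q}"
    show "(\<Sum>n\<in>P. x n) = (\<Sum>t | t \<in> \<tau> \<and> t + j \<in> P. x (t + j))"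
    proof (rule sum.reindex_bij_witness[of _ "\<lambda>t. t + j" "\<lambda>n. n - j"])
      fix n assume n: "n \<in> P"
      hence "j \<le> n" using range j by force
      thus "n - j + j = n" "x (n - j + j) = x n" by simp_all
      show "n - j \<in> {t \<in> \<tau>. t + j \<in> P}"
        using P(3)[OF n] j n \<open>j \<le> n\<close> unfolding \<tau>_def by auto
    qed auto
  qed
  also have "\<dots> = (\<Sum>t\<in>\<tau>. \<Sum>j | j \<in> {..<Q} \<and> t + j \<in> P. x (t + j))"
    by (rule sum.swap_restrict) (auto simp: \<tau>_def)
  also have "\<dots> = (\<Sum>t\<in>\<tau>. \<Sum>j | j < Q \<and> t + j \<in> P. x (t + j))"
    by (simp only: lessThan_iff)
  finally have "real Q * norm (\<Sum>n\<in>P. x n) = norm (\<Sum>t\<in>\<tau>. \<Sum>j | j < Q \<and> t + j \<in> P. x (t + j))"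
    by (metis norm_mult norm_of_nat)
  also have "\<dots> \<le> (\<Sum>t\<in>\<tau>. norm (\<Sum>j | j < Q \<and> t + j \<in> P. x (t + j)))"
    by (rule norm_sum)
  finally have "(real Q * norm (\<Sum>n\<in>P. x n))\<^sup>2 \<le> (\<Sum>t\<in>\<tau>. norm (\<Sum>j | j < Q \<and> t + j \<in> P. x (t + j)))\<^sup>2"
    by (intro power_mono) auto
  also have "\<dots> \<le> real (card \<tau>) * (\<Sum>t\<in>\<tau>. (norm (\<Sum>j | j < Q \<and> t + j \<in> P. x (t + j)))\<^sup>2)"
    using sum_squared_le_sum_of_squares[of "\<lambda>t. norm (\<Sum>j | j < Q \<and> t + j \<in> P. x (t + j))" \<tau>]
    by (simp add: mult.commute)
  also have "\<dots> \<le> K * (\<Sum>t\<le>X. (norm (\<Sum>j | j < Q \<and> t + j \<in> P. x (t + j)))\<^sup>2)"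
  proof (intro mult_mono card sum_mono2)
    show "0 \<le> K" using card of_nat_0_le_iff[of "card \<tau>", where ?'a = real] by linarith
  qed (use \<open>Max P \<le> X\<close> in \<open>auto simp: \<tau>_def intro: sum_nonneg\<close>)
  finally show ?thesis .
qed

text \<open>The coefficient of the pair (k, l) after a window square is opened and summed over
  \<open>m\<close>. Setting it to zero unless both exceed \<open>V\<close> lets it be summed over
  all shifts without side conditions.\<close>

definition bilinear_correlation ::
  "nat set \<Rightarrow> nat set \<Rightarrow> nat \<Rightarrow> (nat \<Rightarrow> complex) \<Rightarrow> (nat \<Rightarrow> complex) \<Rightarrow> nat \<Rightarrow> nat \<Rightarrow> complex" where
  "bilinear_correlation M J V b E k l =
     (if V < k \<and> V < l then b k * cnj (b l) * (\<Sum>m | m \<in> M \<and> m * k \<in> J \<and> m * l \<in> J. E (m * k) * cnj (E (m * l)))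
      else 0)"

text \<open>The weight \<open>m\<close> compensates for the length \<open>N / m\<close> of the inner sum,
  so that after the shift the sum over \<open>m\<close> carries no weight.\<close>
lemma sum_bilinear_shift_le:
  fixes b E :: "nat \<Rightarrow> complex" and N N2 :: real
  defines "J \<equiv> {n. N < real n \<and> real n \<le> N2}"
  assumes M: "finite M" "0 \<notin> M" and N: "N > 0" "N2 \<le> 2 * N" "2 * N < real X + 1" and "Q \<le> V"
  shows "(\<Sum>m\<in>M. real m * (real Q * norm (\<Sum>k | V < k \<and> m * k \<in> J. b k * E (m * k)))\<^sup>2)
           \<le> 3 * N * (\<Sum>t\<le>X. \<Sum>i<Q. \<Sum>j<Q. norm (bilinear_correlation M J V b E (t + i) (t + j)))"
proof -
  define P where "P m = {k. V < k \<and> m * k \<in> J}" for m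
  define y where "y m k = b k * E (m * k)" for m k
  have le_X: "k \<le> X" if "m > 0" "m * k \<in> J" for m k
  proof -
    have "k \<le> m * k" using that by simp
    also have "real (m * k) < real X + 1" using that N unfolding J_def by auto
    hence "m * k \<le> X" by linarith
    finally show ?thesis .
  qed
  have shift: "real m * (real Q * norm (\<Sum>k\<in>P m. y m k))\<^sup>2
      \<le> 3 * N * (\<Sum>t\<le>X. (norm (\<Sum>j | j < Q \<and> t + j \<in> P m. y m (t + j)))\<^sup>2)" if m: "m \<in> M" for m
  proof -
    have "m > 0" using m M by (cases m) auto
    have "(real Q * norm (\<Sum>k\<in>P m. y m k))\<^sup>2
        \<le> (3 * N / real m) * (\<Sum>t\<le>X. (norm (\<Sum>j | j < Q \<and> t + j \<in> P m. y m (t + j)))\<^sup>2)"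
    proof (rule Weyl_shift)
      show "finite (P m)"
        by (rule finite_subset[of _ "{..X}"]) (use le_X[OF \<open>m > 0\<close>] in \<open>auto simp: P_def\<close>)
      show "Q \<le> k \<and> k \<le> X" if "k \<in> P m" for k
        using that le_X[OF \<open>m > 0\<close>] \<open>Q \<le> V\<close> by (auto simp: P_def)
      fix k l assume kl: "k \<in> P m" "l \<in> P m" "k \<le> l"
      \<comment> \<open>The constant 3 arises here: the spread l - k is below N / m, and Q <= l is
        at most 2 N / m.\<close>
      have "N < real m * real k" "real m * real l \<le> 2 * N" "Q \<le> l"
        using kl N \<open>Q \<le> V\<close> by (auto simp: P_def J_def)
      moreover have "real m * real Q \<le> real m * real l"
        using \<open>Q \<le> l\<close> by (intro mult_left_mono) auto
      moreover have "real m * (real (l - k) + real Q) = real m * real l - real m * real k + real m * real Q"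
        using kl by (simp add: of_nat_diff algebra_simps)
      ultimately have "real m * (real (l - k) + real Q) \<le> 3 * N" by linarith
      thus "real (l - k) + real Q \<le> 3 * N / real m"
        using \<open>m > 0\<close> by (simp add: field_simps)
    qed
    from mult_left_mono[OF this, of "real m"] show ?thesis using \<open>m > 0\<close> by simp
  qed
  have expand: "complex_of_real ((norm (\<Sum>j | j < Q \<and> t + j \<in> P m. y m (t + j)))\<^sup>2)
      = (\<Sum>i<Q. \<Sum>j<Q. if t + i \<in> P m \<and> t + j \<in> P m then y m (t + i) * cnj (y m (t + j)) else 0)"
    (is "?lhs = ?rhs") for m t
  proof -
    define f where "f j = (if t + j \<in> P m then y m (t + j) else 0)" for j
    have "(\<Sum>j | j < Q \<and> t + j \<in> P m. y m (t + j)) = (\<Sum>j | j \<in> {..<Q} \<and> t + j \<in> P m. y m (t + j))"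
      by simp
    also have "\<dots> = (\<Sum>j<Q. f j)"
      unfolding f_def by (rule sum.inter_filter) simp
    finally have "?lhs = (\<Sum>i<Q. f i) * cnj (\<Sum>j<Q. f j)"
      by (simp only: complex_norm_square)
    also have "\<dots> = (\<Sum>i<Q. \<Sum>j<Q. f i * cnj (f j))"
      by (simp add: sum_product)
    also have "\<dots> = ?rhs" by (intro sum.cong refl) (simp add: f_def)
    finally show ?thesis .
  qed
  let ?c = "bilinear_correlation M J V b E"
  have corr: "?c k l = (\<Sum>m\<in>M. if k \<in> P m \<and> l \<in> P m then y m k * cnj (y m l) else 0)" for k l
  proof (cases "V < k \<and> V < l")
    case True
    have "?c k l = (\<Sum>m | m \<in> M \<and> m * k \<in> J \<and> m * l \<in> J. y m k * cnj (y m l))"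
      using True by (simp add: bilinear_correlation_def y_def sum_distrib_left mult_ac)
    also have "\<dots> = (\<Sum>m\<in>M. if m * k \<in> J \<and> m * l \<in> J then y m k * cnj (y m l) else 0)"
      using M by (intro sum.inter_filter)
    also have "\<dots> = (\<Sum>m\<in>M. if k \<in> P m \<and> l \<in> P m then y m k * cnj (y m l) else 0)"
      using True by (intro sum.cong refl) (simp add: P_def)
    finally show ?thesis .
  next
    case False
    hence "\<not> (k \<in> P m \<and> l \<in> P m)" for m by (auto simp: P_def)
    hence "(\<Sum>m\<in>M. if k \<in> P m \<and> l \<in> P m then y m k * cnj (y m l) else 0) = 0"
      by (intro sum.neutral) auto
    moreover have "?c k l = 0"
      unfolding bilinear_correlation_def by (rule if_not_P[OF False])
    ultimately show ?thesis by simp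
  qed
  let ?Z = "\<Sum>m\<in>M. \<Sum>t\<le>X. (norm (\<Sum>j | j < Q \<and> t + j \<in> P m. y m (t + j)))\<^sup>2"
  let ?f = "\<lambda>m t i j. if t + i \<in> P m \<and> t + j \<in> P m then y m (t + i) * cnj (y m (t + j)) else 0"
  have "complex_of_real ?Z = (\<Sum>m\<in>M. \<Sum>t\<le>X. \<Sum>i<Q. \<Sum>j<Q. ?f m t i j)"
    by (simp only: of_real_sum expand)
  \<comment> \<open>The sum over \<open>m\<close> is moved innermost before any norm is taken, which
    preserves its cancellation.\<close>
  also have "\<dots> = (\<Sum>t\<le>X. \<Sum>m\<in>M. \<Sum>i<Q. \<Sum>j<Q. ?f m t i j)"
    by (rule sum.swap)
  also have "\<dots> = (\<Sum>t\<le>X. \<Sum>i<Q. \<Sum>m\<in>M. \<Sum>j<Q. ?f m t i j)"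
    by (rule sum.cong[OF refl], rule sum.swap)
  also have "\<dots> = (\<Sum>t\<le>X. \<Sum>i<Q. \<Sum>j<Q. \<Sum>m\<in>M. ?f m t i j)"
    by (rule sum.cong[OF refl], rule sum.cong[OF refl], rule sum.swap)
  also have "\<dots> = (\<Sum>t\<le>X. \<Sum>i<Q. \<Sum>j<Q. ?c (t + i) (t + j))"
    by (simp only: corr)
  finally have Z_eq: "complex_of_real ?Z = (\<Sum>t\<le>X. \<Sum>i<Q. \<Sum>j<Q. ?c (t + i) (t + j))" .
  have "\<bar>?Z\<bar> = norm (complex_of_real ?Z)" by (rule norm_of_real[symmetric])
  also have "\<dots> = norm (\<Sum>t\<le>X. \<Sum>i<Q. \<Sum>j<Q. ?c (t + i) (t + j))"
    by (simp only: Z_eq)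
  also have "\<dots> \<le> (\<Sum>t\<le>X. \<Sum>i<Q. \<Sum>j<Q. norm (?c (t + i) (t + j)))"
    by (rule order_trans[OF norm_sum], rule sum_mono, rule order_trans[OF norm_sum], rule sum_mono, rule norm_sum)
  finally have Z: "?Z \<le> \<dots>" by (rule order_trans[OF abs_ge_self])
  have "(\<Sum>m\<in>M. real m * (real Q * norm (\<Sum>k\<in>P m. y m k))\<^sup>2)
     \<le> (\<Sum>m\<in>M. 3 * N * (\<Sum>t\<le>X. (norm (\<Sum>j | j < Q \<and> t + j \<in> P m. y m (t + j)))\<^sup>2))"
    by (intro sum_mono shift)
  also have "\<dots> = 3 * N * ?Z" by (simp only: sum_distrib_left)
  also have "\<dots> \<le> 3 * N * (\<Sum>t\<le>X. \<Sum>i<Q. \<Sum>j<Q. norm (?c (t + i) (t + j)))"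
    by (rule mult_left_mono[OF Z]) (use N in simp)
  finally show ?thesis by (simp only: P_def y_def mem_Collect_eq)
qed

lemma sum_inverse_sqrt_le: "(\<Sum>n=1..R. 1 / sqrt (real n)) \<le> 2 * sqrt (real R)"
proof (induction R)
  case (Suc n)
  let ?a = "sqrt (real n)" and ?b = "sqrt (real (Suc n))"
  have ab: "0 \<le> ?a" "?a \<le> ?b" "?b > 0" "?a\<^sup>2 = real n" "?b\<^sup>2 = real n + 1" by auto
  have "1 = (?b - ?a) * (?b + ?a)" using ab by (simp add: algebra_simps power2_eq_square)
  also have "\<dots> \<le> (?b - ?a) * (2 * ?b)" using ab by (intro mult_left_mono) auto
  finally have "1 / ?b \<le> 2 * (?b - ?a)" using ab by (simp add: field_simps)
  thus ?case using Suc by (simp del: of_nat_Suc)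
qed auto

lemma sum_shift_le:
  fixes B :: "nat \<Rightarrow> real"
  assumes "finite F" "\<And>n. B n \<ge> 0" "\<And>n. n \<notin> F \<Longrightarrow> B n = 0"
  shows "(\<Sum>t\<le>X. B (t + j)) \<le> (\<Sum>n\<in>F. B n)"
proof -
  have "(\<Sum>t\<le>X. B (t + j)) = (\<Sum>n\<in>(\<lambda>t. t + j) ` {..X}. B n)"
    by (subst sum.reindex) auto
  also have "\<dots> \<le> (\<Sum>n\<in>(\<lambda>t. t + j) ` {..X} \<union> F. B n)"
    using assms by (intro sum_mono2) auto
  also have "\<dots> = (\<Sum>n\<in>F. B n)"
    using assms by (intro sum.mono_neutral_right) auto
  finally show ?thesis .
qed

subsection \<open>Divisor moments and type II correlations\<close>

lemma card_divisors_mult_le: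
  fixes a b :: nat
  assumes "a > 0" "b > 0"
  shows "card {d. d dvd a * b} \<le> card {d. d dvd a} * card {d. d dvd b}"
proof -
  have "{d. d dvd a * b} \<subseteq> (\<lambda>(x, y). x * y) ` ({d. d dvd a} \<times> {d. d dvd b})"
    by (auto dest!: division_decomp)
  hence "card {d. d dvd a * b} \<le> card ({d. d dvd a} \<times> {d. d dvd b})"
    using assms by (intro surj_card_le) auto
  thus ?thesis by (simp add: card_cartesian_product)
qed

text \<open>The pairs (d, n / d) are the pairs (a, b) with a b <= X; enlarging this hyperbolic
  region to a square makes product sums factor.\<close>

lemma sum_over_divisors_le:
  fixes G :: "nat \<Rightarrow> nat \<Rightarrow> real"
  assumes "\<And>a b. 0 \<le> G a b"
  shows "(\<Sum>n=1..X. \<Sum>d | d dvd n. G d (n div d)) \<le> (\<Sum>a=1..X. \<Sum>b=1..X. G a b)"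
proof -
  have "(\<Sum>n=1..X. \<Sum>d | d dvd n. G d (n div d))
      = (\<Sum>n\<in>{1..X}. \<Sum>d | d \<in> {1..X} \<and> d dvd n. G d (n div d))"
  proof (intro sum.cong refl)
    fix n assume n: "n \<in> {1..X}"
    show "{d. d dvd n} = {d. d \<in> {1..X} \<and> d dvd n}"
    proof safe
      fix d assume "d dvd n"
      thus "d \<in> {1..X}" using n dvd_imp_le[of d n] dvd_pos_nat[of n d] by auto
    qed
  qed
  also have "\<dots> = (\<Sum>a\<in>{1..X}. \<Sum>b | a * b \<in> {1..X}. G a (a * b div a))"
    by (rule sum_divisors_swap) auto
  also have "\<dots> \<le> (\<Sum>a=1..X. \<Sum>b=1..X. G a b)"
  proof (rule sum_mono)
    fix a assume a: "a \<in> {1..X}"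
    have "{b. a * b \<in> {1..X}} \<subseteq> {1..X}"
    proof safe
      fix b assume b: "a * b \<in> {1..X}"
      hence "b > 0" by (cases b) auto
      moreover have "b \<le> X" using a b by (intro le_trans[of b "a * b" X]) auto
      ultimately show "b \<in> {1..X}" by simp
    qed
    moreover have "(\<Sum>b | a * b \<in> {1..X}. G a (a * b div a)) = (\<Sum>b | a * b \<in> {1..X}. G a b)"
      using a by simp
    ultimately show "(\<Sum>b | a * b \<in> {1..X}. G a (a * b div a)) \<le> (\<Sum>b=1..X. G a b)"
      using assms by (simp add: sum_mono2)
  qed
  finally show ?thesis .
qed

text \<open>One factor of the squared divisor count becomes a sum over d, the other is
  submultiplicative, and 1 / m splits as well; so the sum is at most the square of its first-moment
  analogue. The same argument bounds that by the square of the harmonic sum.\<close>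

lemma sum_card_divisors_sq_le:
  "(\<Sum>m=1..X. (real (card {d. d dvd m}))\<^sup>2 / real m) \<le> (\<Sum>m=1..X. 1 / real m) ^ 4"
proof -
  let ?\<tau> = "\<lambda>m::nat. real (card {d. d dvd m})"
  have 1: "(\<Sum>m=1..X. ?\<tau> m / real m) \<le> (\<Sum>m=1..X. 1 / real m)\<^sup>2"
  proof -
    have "(\<Sum>m=1..X. ?\<tau> m / real m) = (\<Sum>m=1..X. \<Sum>d | d dvd m. 1 / (real d * real (m div d)))"
    proof (rule sum.cong[OF refl])
      fix m assume "m \<in> {1..X}"
      have "(\<Sum>d | d dvd m. 1 / (real d * real (m div d))) = (\<Sum>d | d dvd m. 1 / real m)"
        by (intro sum.cong refl) (auto simp flip: of_nat_mult)
      thus "?\<tau> m / real m = (\<Sum>d | d dvd m. 1 / (real d * real (m div d)))" by simp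
    qed
    also have "\<dots> \<le> (\<Sum>a=1..X. \<Sum>b=1..X. 1 / (real a * real b))"
      by (rule sum_over_divisors_le) auto
    also have "\<dots> = (\<Sum>m=1..X. 1 / real m)\<^sup>2"
      by (simp add: power2_eq_square sum_product)
    finally show ?thesis .
  qed
  have "(\<Sum>m=1..X. (?\<tau> m)\<^sup>2 / real m) \<le> (\<Sum>m=1..X. \<Sum>d | d dvd m. (?\<tau> d / real d) * (?\<tau> (m div d) / real (m div d)))"
  proof (rule sum_mono)
    fix m assume m: "m \<in> {1..X}"
    have "(?\<tau> m)\<^sup>2 / real m = (\<Sum>d | d dvd m. ?\<tau> m / real m)"
      by (simp add: power2_eq_square)
    also have "\<dots> \<le> (\<Sum>d | d dvd m. (?\<tau> d / real d) * (?\<tau> (m div d) / real (m div d)))"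
    proof (rule sum_mono)
      fix d assume "d \<in> {d. d dvd m}"
      then obtain k where k: "m = d * k" by auto
      have "d > 0" "k > 0" using k m by (auto intro: Nat.gr0I)
      have "?\<tau> m \<le> ?\<tau> d * ?\<tau> k"
        using card_divisors_mult_le[OF \<open>d > 0\<close> \<open>k > 0\<close>] by (simp only: k flip: of_nat_mult)
      thus "?\<tau> m / real m \<le> (?\<tau> d / real d) * (?\<tau> (m div d) / real (m div d))"
        using k \<open>d > 0\<close> \<open>k > 0\<close> by (simp add: divide_right_mono)
    qed
    finally show "(?\<tau> m)\<^sup>2 / real m \<le> \<dots>" .
  qed
  also have "\<dots> \<le> (\<Sum>a=1..X. \<Sum>b=1..X. (?\<tau> a / real a) * (?\<tau> b / real b))"
    by (rule sum_over_divisors_le) auto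
  also have "\<dots> = (\<Sum>m=1..X. ?\<tau> m / real m)\<^sup>2"
    by (simp add: power2_eq_square sum_product)
  also have "\<dots> \<le> ((\<Sum>m=1..X. 1 / real m)\<^sup>2)\<^sup>2"
    by (intro power_mono 1 sum_nonneg) auto
  finally show ?thesis by simp
qed

lemma sum_inverse_le_ln:
  assumes "N \<ge> 2" "ln N \<ge> 1" "real X \<le> 2 * N"
  shows "(\<Sum>m=1..X. 1 / real m) \<le> 3 * ln N"
proof (cases "X = 0")
  case False
  have "(\<Sum>m=1..X. 1 / real m) = harm X"
    by (simp add: harm_def inverse_eq_divide)
  also have "\<dots> \<le> ln (real X) + 1" using euler_mascheroni_sequence_decreasing[of 1 X] False by (simp add: harm_expand)
  also have "ln (real X) \<le> ln (2 * N)" using assms False by simp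
  also have "\<dots> \<le> 2 * ln N" using ln_bounds[of N "2 * N"] assms by auto
  finally show ?thesis using assms by linarith
qed (use assms in auto)

section \<open>Correlations on and off the diagonal\<close>

text \<open>With k = l there is no oscillation: at most 2 N / n values of \<open>m\<close> occur,
  and the two von Mangoldt factors give 4 L^2.\<close>

lemma norm_correlation_diag_le:
  fixes N N2 :: real
  defines "J \<equiv> {n. N < real n \<and> real n \<le> N2}"
  assumes N: "N \<ge> 2" "N2 \<le> 2 * N" "2 * N < real X + 1" and E: "\<And>n. norm (E n) = 1" and "0 \<notin> M"
  shows "norm (bilinear_correlation M J V mangoldt E n n)
           \<le> 8 * (ln N)\<^sup>2 * N * (if n \<in> {1..X} then 1 / real n else 0)"
proof -
  define A where "A = {m. m \<in> M \<and> m * n \<in> J}"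
  show ?thesis
  proof (cases "V < n \<and> A \<noteq> {}")
    case False
    hence "bilinear_correlation M J V mangoldt E n n = 0"
      unfolding bilinear_correlation_def A_def by (cases "V < n") (simp_all del: Collect_empty_eq)
    thus ?thesis using N by simp
  next
    case True
    hence "n > 0" by auto
    have A: "m > 0 \<and> real m * real n \<le> 2 * N" if "m \<in> A" for m
      using that N \<open>0 \<notin> M\<close> by (auto simp: A_def J_def intro: Nat.gr0I)
    obtain m where "m \<in> A" using True by auto
    note m = A[OF this]
    have "1 * real n \<le> real m * real n" using m by (intro mult_right_mono) auto
    hence n2N: "real n \<le> 2 * N" using m by linarith
    hence "n \<le> X" using N by linarith
    have "A \<subseteq> {1..nat \<lfloor>2 * N / real n\<rfloor>}"
    proof
      fix m assume "m \<in> A"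
      thus "m \<in> {1..nat \<lfloor>2 * N / real n\<rfloor>}"
        using A[of m] \<open>n > 0\<close> by (auto intro!: le_nat_floor simp: field_simps)
    qed
    hence "card A \<le> nat \<lfloor>2 * N / real n\<rfloor>" using card_mono[of "{1..nat \<lfloor>2 * N / real n\<rfloor>}" A] by simp
    hence "real (card A) \<le> real (nat \<lfloor>2 * N / real n\<rfloor>)" by simp
    also have "\<dots> \<le> 2 * N / real n" using N by (intro of_nat_floor) auto
    finally have card: "real (card A) \<le> 2 * N / real n" .
    have "mangoldt n \<le> ln (real n)" using mangoldt_le[of n] \<open>n > 0\<close> by simp
    also have "\<dots> \<le> ln (2 * N)" using n2N \<open>n > 0\<close> by simp
    also have "\<dots> \<le> 2 * ln N" using ln_bounds[of N "2 * N"] N by auto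
    finally have mang: "mangoldt n \<le> 2 * ln N" .
    have "norm (bilinear_correlation M J V mangoldt E n n)
        = (mangoldt n)\<^sup>2 * norm (\<Sum>m\<in>A. E (m * n) * cnj (E (m * n)))"
      using True by (simp add: bilinear_correlation_def A_def norm_mult power2_eq_square)
    also have "norm (\<Sum>m\<in>A. E (m * n) * cnj (E (m * n))) \<le> real (card A)"
      by (rule order_trans[OF norm_sum]) (simp add: norm_mult E)
    also have "(mangoldt n)\<^sup>2 * real (card A) \<le> (2 * ln N)\<^sup>2 * (2 * N / real n)"
      using mang card mangoldt_nonneg[of n] by (intro mult_mono power_mono) auto
    finally show ?thesis using \<open>n > 0\<close> \<open>n \<le> X\<close> by (simp add: mult_left_mono)
  qed
qed

text \<open>The condition m > U forces k <= 2 N / U, which explains the indicator. With l - k <= Q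
  <= U / 2 it also gives (l - k) k <= N, as \<open>norm_sum_e_Li_diff_le\<close> requires. The two
  von Mangoldt factors turn 96 L^5 into 384 L^7.\<close>

lemma norm_correlation_offdiag_le:
  fixes N N2 :: real and h :: int
  defines "J \<equiv> {n. N < real n \<and> real n \<le> N2}"
  defines "E \<equiv> \<lambda>n. e (of_int h * Li (real n))"
  assumes N: "N \<ge> 2" "ln N \<ge> 4" "N2 \<le> 2 * N" and h: "0 < h" "of_int h \<le> ln N ^ 4"
    and kl: "k < l" "l - k \<le> Q" and QU: "2 * Q \<le> U"
  shows "norm (bilinear_correlation {U<..X} J V mangoldt E k l)
           \<le> 384 * ln N ^ 7 * sqrt (real Q * N) * (if k \<in> {1..nat \<lfloor>2 * N / real U\<rfloor>} then 1 / sqrt (real k) else 0)"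
proof -
  define A where "A = {m. m \<in> {U<..X} \<and> m * k \<in> J \<and> m * l \<in> J}"
  show ?thesis
  proof (cases "V < k \<and> A \<noteq> {}")
    case False
    hence "bilinear_correlation {U<..X} J V mangoldt E k l = 0"
      unfolding bilinear_correlation_def A_def by (cases "V < k") (simp_all del: Collect_empty_eq)
    thus ?thesis using N by simp
  next
    case True
    hence "k > 0" by auto
    have "Q > 0" using kl by linarith
    hence "U > 0" using QU by linarith
    obtain m where m: "m \<in> A" using True by auto
    have mU: "real U \<le> real m" "real m \<ge> 1" using m by (auto simp: A_def)
    have ml: "real m * real l \<le> 2 * N" using m N by (auto simp: A_def J_def)
    have "real U * real k \<le> real m * real l" using mU kl by (intro mult_mono) auto
    hence Uk: "real U * real k \<le> 2 * N" using ml by linarith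
    hence kR: "k \<in> {1..nat \<lfloor>2 * N / real U\<rfloor>}"
      using \<open>k > 0\<close> \<open>U > 0\<close> by (auto intro!: le_nat_floor simp: field_simps)
    have "1 * real l \<le> real m * real l" using mU by (intro mult_right_mono) auto
    hence l2N: "real l \<le> 2 * N" using ml by linarith
    have mang: "mangoldt n \<le> 2 * ln N" if "0 < n" "n \<le> l" for n
    proof -
      have "mangoldt n \<le> ln (real n)" using mangoldt_le[of n] that by simp
      also have "\<dots> \<le> ln (2 * N)" using l2N that by simp
      also have "\<dots> \<le> 2 * ln N" using ln_bounds[of N "2 * N"] N by auto
      finally show ?thesis .
    qed
    have lk: "real (l - k) \<le> real Q" using kl by simp
    have "norm (\<Sum>m\<in>A. e (of_int h * (Li (real (m * k)) - Li (real (m * l)))))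
        \<le> 96 * ln N ^ 5 * sqrt (real (l - k) * N / real k)"
    proof (rule norm_sum_e_Li_diff_le)
      have "real (l - k) * real k \<le> (real U / 2) * real k"
        using lk QU by (intro mult_right_mono) auto
      thus "real (l - k) * real k \<le> N" using Uk by simp
      show "order_convex A"
        unfolding order_convex_def
      proof safe
        fix x y z assume xz: "x \<in> A" "z \<in> A" "y \<in> {x..z}"
        hence "x * k \<le> y * k" "y * k \<le> z * k" "x * l \<le> y * l" "y * l \<le> z * l" by auto
        hence "real (x * k) \<le> real (y * k)" "real (y * k) \<le> real (z * k)"
              "real (x * l) \<le> real (y * l)" "real (y * l) \<le> real (z * l)"
          by (simp_all only: of_nat_le_iff)
        thus "y \<in> A" using xz unfolding A_def J_def by auto
      qed
      show "A \<subseteq> {m. N < real (m * k) \<and> real (m * l) \<le> N2}" by (auto simp: A_def J_def)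
    qed (use N h kl \<open>k > 0\<close> in auto)
    also have "\<dots> \<le> 96 * ln N ^ 5 * sqrt (real Q * N / real k)"
      using lk N by (intro mult_left_mono real_sqrt_le_mono divide_right_mono mult_right_mono) auto
    finally have bound: "norm (\<Sum>m\<in>A. e (of_int h * (Li (real (m * k)) - Li (real (m * l)))))
        \<le> 96 * ln N ^ 5 * sqrt (real Q * N / real k)" .
    have "norm (bilinear_correlation {U<..X} J V mangoldt E k l)
        = mangoldt k * mangoldt l * norm (\<Sum>m\<in>A. E (m * k) * cnj (E (m * l)))"
      using True kl by (simp add: bilinear_correlation_def A_def norm_mult)
    also have "(\<Sum>m\<in>A. E (m * k) * cnj (E (m * l)))
        = (\<Sum>m\<in>A. e (of_int h * (Li (real (m * k)) - Li (real (m * l)))))"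
      by (intro sum.cong refl) (simp add: E_def cnj_e right_diff_distrib flip: e_add)
    also have "mangoldt k * mangoldt l * norm \<dots>
        \<le> (2 * ln N) * (2 * ln N) * (96 * ln N ^ 5 * sqrt (real Q * N / real k))"
      using mang[of k] mang[of l] kl \<open>k > 0\<close> N
      by (intro mult_mono bound mult_nonneg_nonneg mangoldt_nonneg) auto
    also have "\<dots> = 384 * ln N ^ 7 * sqrt (real Q * N) * (1 / sqrt (real k))"
      by (simp add: real_sqrt_divide eval_nat_numeral)
    finally show ?thesis using kR by simp
  qed
qed

lemma norm_bilinear_correlation_commute:
  "norm (bilinear_correlation M J V b E k l) = norm (bilinear_correlation M J V b E l k)"
proof -
  have "bilinear_correlation M J V b E l k = cnj (bilinear_correlation M J V b E k l)"
    by (auto simp: bilinear_correlation_def mult_ac conj_commute intro!: sum.cong)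
  thus ?thesis by simp
qed

subsection \<open>Type I and type II estimates\<close>

text \<open>For fixed (i, j) the sum over \<open>t\<close> is harmonic on the diagonal and a sum of
  inverse square roots up to 2 N / U off it. There are \<open>Q\<close> diagonal pairs and at most
  Q^2 others.\<close>

lemma sum_correlations_le:
  fixes N N2 :: real and h :: int
  defines "L \<equiv> ln N"
  defines "J \<equiv> {n. N < real n \<and> real n \<le> N2}"
  defines "E \<equiv> \<lambda>n. e (of_int h * Li (real n))"
  assumes N: "N \<ge> 2" "L \<ge> 4" "N2 \<le> 2 * N" and X: "real X \<le> 2 * N" "2 * N < real X + 1"
    and h: "0 < h" "of_int h \<le> L ^ 4" and QU: "2 * Q \<le> U"
  shows "(\<Sum>t\<le>X. \<Sum>i<Q. \<Sum>j<Q. norm (bilinear_correlation {U<..X} J V mangoldt E (t + i) (t + j)))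
           \<le> 24 * L ^ 3 * N * real Q
             + 1536 * L ^ 7 * sqrt (real Q * N) * sqrt (2 * N / real U) * (real Q)\<^sup>2"
proof -
  let ?c = "bilinear_correlation {U<..X} J V mangoldt E"
  define R where "R = nat \<lfloor>2 * N / real U\<rfloor>"
  define D where "D n = (if n \<in> {1..X} then 1 / real n else 0)" for n
  define B where "B n = (if n \<in> {1..R} then 1 / sqrt (real n) else 0)" for n
  define C1 where "C1 = 8 * L\<^sup>2 * N"
  define C2 where "C2 = 384 * L ^ 7 * sqrt (real Q * N)"
  have C: "C1 \<ge> 0" "C2 \<ge> 0" using N by (auto simp: C1_def C2_def)
  have nonneg: "D n \<ge> 0" "B n \<ge> 0" for n by (auto simp: D_def B_def)
  have sum_D: "(\<Sum>t\<le>X. D (t + i)) \<le> 3 * L" for i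
  proof -
    have "(\<Sum>t\<le>X. D (t + i)) \<le> (\<Sum>n\<in>{1..X}. D n)"
      by (rule sum_shift_le) (auto simp: D_def)
    also have "\<dots> = (\<Sum>n=1..X. 1 / real n)" by (simp add: D_def)
    also have "\<dots> \<le> 3 * L" unfolding L_def using N X by (intro sum_inverse_le_ln) (auto simp: L_def)
    finally show ?thesis .
  qed
  have sum_B: "(\<Sum>t\<le>X. B (t + i)) \<le> 2 * sqrt (2 * N / real U)" for i
  proof -
    have "(\<Sum>t\<le>X. B (t + i)) \<le> (\<Sum>n\<in>{1..R}. B n)"
      by (rule sum_shift_le) (auto simp: B_def)
    also have "\<dots> = (\<Sum>n=1..R. 1 / sqrt (real n))" by (simp add: B_def)
    also have "\<dots> \<le> 2 * sqrt (real R)" by (rule sum_inverse_sqrt_le)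
    also have "real R \<le> 2 * N / real U" unfolding R_def using N by (intro of_nat_floor) auto
    finally show ?thesis by simp
  qed
  have off: "norm (?c k l) \<le> C2 * B k" if "k < l" "l - k \<le> Q" for k l
    using norm_correlation_offdiag_le[of N N2 h k l Q U X V] that N h QU
    unfolding L_def J_def E_def C2_def B_def R_def by auto
  \<comment> \<open>Charging \<open>B\<close> at both indices gives a symmetric bound, whichever
    index is smaller.\<close>
  have point: "norm (?c (t + i) (t + j)) \<le> (if i = j then C1 * D (t + i) else 0) + C2 * (B (t + i) + B (t + j))"
    if "i < Q" "j < Q" for t i j
  proof -
    have nn: "C2 * B (t + i) \<ge> 0" "C2 * B (t + j) \<ge> 0" using C nonneg by auto
    consider "i = j" | "i < j" | "j < i" by linarith
    thus ?thesis
    proof cases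
      case 1
      have "norm (?c (t + i) (t + i)) \<le> C1 * D (t + i)"
        unfolding C1_def D_def L_def J_def
        by (rule norm_correlation_diag_le) (use N X in \<open>auto simp: E_def\<close>)
      thus ?thesis using 1 nn by (simp add: distrib_left)
    next
      case 2
      hence "norm (?c (t + i) (t + j)) \<le> C2 * B (t + i)" using that by (intro off) auto
      thus ?thesis using 2 nn by (simp add: distrib_left)
    next
      case 3
      hence "norm (?c (t + j) (t + i)) \<le> C2 * B (t + j)" using that by (intro off) auto
      thus ?thesis using 3 nn
        by (simp add: distrib_left norm_bilinear_correlation_commute[of _ _ _ _ _ "t + i"])
    qed
  qed
  have "(\<Sum>t\<le>X. \<Sum>i<Q. \<Sum>j<Q. norm (?c (t + i) (t + j)))
      = (\<Sum>i<Q. \<Sum>t\<le>X. \<Sum>j<Q. norm (?c (t + i) (t + j)))"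
    by (rule sum.swap)
  also have "\<dots> = (\<Sum>i<Q. \<Sum>j<Q. \<Sum>t\<le>X. norm (?c (t + i) (t + j)))"
    by (rule sum.cong[OF refl], rule sum.swap)
  also have "\<dots> \<le> (\<Sum>i<Q. \<Sum>j<Q. (if i = j then C1 * (3 * L) else 0) + C2 * (4 * sqrt (2 * N / real U)))"
  proof (intro sum_mono)
    fix i j assume ij: "i \<in> {..<Q}" "j \<in> {..<Q}"
    have "(\<Sum>t\<le>X. norm (?c (t + i) (t + j)))
        \<le> (\<Sum>t\<le>X. (if i = j then C1 * D (t + i) else 0) + C2 * (B (t + i) + B (t + j)))"
      using ij by (intro sum_mono point) auto
    also have "\<dots> = (if i = j then C1 * (\<Sum>t\<le>X. D (t + i)) else 0)
        + C2 * ((\<Sum>t\<le>X. B (t + i)) + (\<Sum>t\<le>X. B (t + j)))"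
      by (simp add: sum.distrib sum_distrib_left distrib_left)
    also have "\<dots> \<le> (if i = j then C1 * (3 * L) else 0)
        + C2 * (2 * sqrt (2 * N / real U) + 2 * sqrt (2 * N / real U))"
      using sum_D[of i] sum_B[of i] sum_B[of j] C
      by (intro add_mono mult_left_mono) (auto intro: mult_left_mono)
    finally show "(\<Sum>t\<le>X. norm (?c (t + i) (t + j)))
        \<le> (if i = j then C1 * (3 * L) else 0) + C2 * (4 * sqrt (2 * N / real U))"
      by simp
  qed
  also have "\<dots> = real Q * (C1 * (3 * L)) + (real Q)\<^sup>2 * (C2 * (4 * sqrt (2 * N / real U)))"
    by (simp add: sum.distrib sum.delta power2_eq_square algebra_simps)
  also have "\<dots> = 24 * L ^ 3 * N * real Q
             + 1536 * L ^ 7 * sqrt (real Q * N) * sqrt (2 * N / real U) * (real Q)\<^sup>2"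
    by (simp add: C1_def C2_def eval_nat_numeral algebra_simps)
  finally show ?thesis .
qed

lemma nat_floor_ge_half:
  fixes x :: real
  assumes "x \<ge> 1"
  shows "x / 2 \<le> real (nat \<lfloor>x\<rfloor>)" "real (nat \<lfloor>x\<rfloor>) \<le> x"
proof -
  have "real (nat \<lfloor>x\<rfloor>) = of_int \<lfloor>x\<rfloor>" using assms by simp
  moreover have "\<lfloor>x\<rfloor> \<ge> 1" using assms by simp
  hence "real_of_int \<lfloor>x\<rfloor> \<ge> 1" by simp
  ultimately show "x / 2 \<le> real (nat \<lfloor>x\<rfloor>)" "real (nat \<lfloor>x\<rfloor>) \<le> x" by linarith+
qed

text \<open>The divisor count stands in as majorant of the truncated Moebius coefficient. The final
  constant is 9 L^2 from its second moment times 100 L^4 from the weighted bilinear sum.\<close>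

lemma type_II_le:
  fixes w N2 :: real and h :: int
  defines "N \<equiv> w ^ 22"
  defines "L \<equiv> ln N"
  defines "J \<equiv> {n. N < real n \<and> real n \<le> N2}"
  defines "E \<equiv> \<lambda>n. e (of_int h * Li (real n))"
  defines "U \<equiv> nat \<lfloor>w ^ 6\<rfloor>" and "V \<equiv> nat \<lfloor>w\<^sup>2\<rfloor>" and "X \<equiv> nat \<lfloor>2 * N\<rfloor>"
  assumes w: "w \<ge> 2" and L: "L \<ge> 4" and N2: "N2 \<le> 2 * N"
    and h: "0 < h" "of_int h \<le> L ^ 4"
  shows "(\<Sum>m\<in>{U<..X}. real (card {d. d dvd m}) * norm (\<Sum>k | V < k \<and> m * k \<in> J. mangoldt k * E (m * k)))
           \<le> 900 * L ^ 6 * w ^ 21"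
proof -
  define T where "T m = norm (\<Sum>k | V < k \<and> m * k \<in> J. mangoldt k * E (m * k))" for m
  have w1: "w ^ k \<ge> 1" for k using w by (intro one_le_power) auto
  have N: "N \<ge> 2"
    using w self_le_power[of w 22] by (auto simp: N_def)
  have V: "w\<^sup>2 / 2 \<le> real V" "real V \<le> w\<^sup>2" and U: "w ^ 6 / 2 \<le> real U" "real U \<le> w ^ 6"
    unfolding U_def V_def by (intro nat_floor_ge_half w1)+
  have X: "real X \<le> 2 * N" "2 * N < real X + 1" 
  proof -
    have "real X = of_int \<lfloor>2 * N\<rfloor>" using N by (simp add: X_def)
    thus "real X \<le> 2 * N" "2 * N < real X + 1" by linarith+
  qed
  have "V > 0" "U > 0" using V(1) U(1) w1[of 2] w1[of 6] by (auto intro!: Nat.gr0I)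
  have VU: "2 * V \<le> U"
  proof -
    have "2 ^ 4 * w\<^sup>2 \<le> w ^ 4 * w\<^sup>2" using w by (intro mult_right_mono power_mono) auto
    also have "\<dots> = w ^ 6" by (simp flip: power_add)
    finally have "16 * w\<^sup>2 \<le> w ^ 6" by simp
    hence "2 * real V \<le> real U" using U V w1[of 2] by linarith
    thus ?thesis by linarith
  qed
  let ?s = "\<Sum>m\<in>{U<..X}. real m * (T m)\<^sup>2"
  have "(real V)\<^sup>2 * ?s = (\<Sum>m\<in>{U<..X}. real m * (real V * T m)\<^sup>2)"
    by (simp add: sum_distrib_left power_mult_distrib mult_ac)
  also have "\<dots> \<le> 3 * N * (\<Sum>t\<le>X. \<Sum>i<V. \<Sum>j<V. norm (bilinear_correlation {U<..X} J V mangoldt E (t + i) (t + j)))"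
    unfolding T_def J_def using N N2 X by (intro sum_bilinear_shift_le) auto
  also have "\<dots> \<le> 3 * N * (24 * L ^ 3 * N * real V
             + 1536 * L ^ 7 * sqrt (real V * N) * sqrt (2 * N / real U) * (real V)\<^sup>2)"
    unfolding J_def E_def L_def
    by (intro mult_left_mono sum_correlations_le) (use N N2 X h L VU in \<open>auto simp: L_def\<close>)
  also have "\<dots> = (real V)\<^sup>2 * (72 * L ^ 3 * N\<^sup>2 / real V + 4608 * L ^ 7 * N * (sqrt (real V * N) * sqrt (2 * N / real U)))"
    using \<open>V > 0\<close> by (simp add: field_simps power2_eq_square)
  finally have "?s \<le> 72 * L ^ 3 * N\<^sup>2 / real V + 4608 * L ^ 7 * N * (sqrt (real V * N) * sqrt (2 * N / real U))"
    using \<open>V > 0\<close> by (simp add: mult_le_cancel_left)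
  \<comment> \<open>Both powers of \<open>L\<close> are raised to 8 so that the bound becomes a
    perfect square; then 144 + 9216 = 9360 <= 100^2.\<close>
  also have "72 * L ^ 3 * N\<^sup>2 / real V \<le> 72 * L ^ 8 * N\<^sup>2 / (w\<^sup>2 / 2)"
    using V w1[of 2] L N by (intro frac_le mult_mono power_increasing) auto
  also have "4608 * L ^ 7 * N * (sqrt (real V * N) * sqrt (2 * N / real U)) \<le> 4608 * L ^ 8 * N * (2 * N / w\<^sup>2)"
  proof (intro mult_mono power_increasing)
    have "real V * N * (2 * N / real U) \<le> w\<^sup>2 * N * (2 * N / (w ^ 6 / 2))"
      using U V N w w1[of 6] \<open>U > 0\<close> by (intro mult_mono divide_left_mono) auto
    also have "\<dots> = (2 * N / w\<^sup>2)\<^sup>2"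
      using w by (simp add: field_simps eval_nat_numeral)
    finally have "sqrt (real V * N * (2 * N / real U)) \<le> 2 * N / w\<^sup>2"
      using N w by (intro real_le_lsqrt) auto
    thus "sqrt (real V * N) * sqrt (2 * N / real U) \<le> 2 * N / w\<^sup>2"
      by (simp only: real_sqrt_mult)
  qed (use N L in auto)
  also have "72 * L ^ 8 * N\<^sup>2 / (w\<^sup>2 / 2) + 4608 * L ^ 8 * N * (2 * N / w\<^sup>2) = 9360 * (L ^ 4 * (N / w))\<^sup>2"
    using w by (simp add: field_simps eval_nat_numeral)
  also have "\<dots> \<le> 100\<^sup>2 * (L ^ 4 * (N / w))\<^sup>2"
    by (intro mult_right_mono) auto
  also have "N / w = w ^ 21" using w by (simp add: N_def eval_nat_numeral)
  also have "100\<^sup>2 * (L ^ 4 * w ^ 21)\<^sup>2 = (100 * L ^ 4 * w ^ 21)\<^sup>2"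
    by (simp add: power_mult_distrib)
  finally have s: "?s \<le> (100 * L ^ 4 * w ^ 21)\<^sup>2" by simp
  let ?\<tau> = "\<lambda>m. real (card {d. d dvd m})"
  have "(\<Sum>m\<in>{U<..X}. (?\<tau> m)\<^sup>2 / real m) \<le> (\<Sum>m=1..X. (?\<tau> m)\<^sup>2 / real m)"
    by (intro sum_mono2) auto
  also have "\<dots> \<le> (\<Sum>m=1..X. 1 / real m) ^ 4" by (rule sum_card_divisors_sq_le)
  also have "\<dots> \<le> (3 * L) ^ 4"
    using sum_inverse_le_ln[of N X] N L X unfolding L_def by (intro power_mono sum_nonneg) auto
  also have "\<dots> = (9 * L\<^sup>2)\<^sup>2" by (simp add: eval_nat_numeral)
  finally have \<tau>: "(\<Sum>m\<in>{U<..X}. (?\<tau> m)\<^sup>2 / real m) \<le> (9 * L\<^sup>2)\<^sup>2" .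
  \<comment> \<open>Splitting off sqrt m for Cauchy's inequality creates the weight \<open>m\<close>
    that \<open>sum_bilinear_shift_le\<close> expects.\<close>
  have "(\<Sum>m\<in>{U<..X}. ?\<tau> m * T m) = (\<Sum>m\<in>{U<..X}. (?\<tau> m / sqrt (real m)) * (sqrt (real m) * T m))"
    by (intro sum.cong) auto
  hence "(\<Sum>m\<in>{U<..X}. ?\<tau> m * T m)\<^sup>2
      \<le> (\<Sum>m\<in>{U<..X}. (?\<tau> m / sqrt (real m))\<^sup>2) * (\<Sum>m\<in>{U<..X}. (sqrt (real m) * T m)\<^sup>2)"
    by (simp only: Cauchy_Schwarz_ineq_sum)
  also have "\<dots> = (\<Sum>m\<in>{U<..X}. (?\<tau> m)\<^sup>2 / real m) * ?s"
    by (simp add: power_divide power_mult_distrib)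
  also have "\<dots> \<le> (9 * L\<^sup>2)\<^sup>2 * (100 * L ^ 4 * w ^ 21)\<^sup>2"
    by (intro mult_mono s \<tau> sum_nonneg) auto
  also have "\<dots> = (900 * L ^ 6 * w ^ 21)\<^sup>2"
    by (simp add: eval_nat_numeral)
  finally show ?thesis
    unfolding T_def by (rule power2_le_imp_le) (use L w in auto)
qed

section \<open>Partial summation, type I sums and assembly\<close>

text \<open>Abel summation from the top end: because the weight increases, tails rather than initial
  segments are bounded, and the cost is only the largest weight.\<close>

lemma norm_sum_weighted_le:
  fixes c :: "nat \<Rightarrow> complex" and \<omega> :: "nat \<Rightarrow> real"
  assumes "u \<le> v" "0 \<le> \<omega> u"
    and mono: "\<And>k. u \<le> k \<Longrightarrow> k < v \<Longrightarrow> \<omega> k \<le> \<omega> (Suc k)"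
    and tail: "\<And>t. u \<le> t \<Longrightarrow> t \<le> v \<Longrightarrow> norm (\<Sum>k=t..v. c k) \<le> B"
  shows "norm (\<Sum>k=u..v. of_real (\<omega> k) * c k) \<le> \<omega> v * B"
proof -
  have "norm ((\<Sum>k=t..v. of_real (\<omega> k) * c k) - of_real (\<omega> t) * (\<Sum>k=t..v. c k)) \<le> (\<omega> v - \<omega> t) * B"
    if "u \<le> t" "t \<le> v" for t
    using that(2,1)
  proof (induction t rule: inc_induct)
    case (step t)
    let ?a = "\<Sum>k=Suc t..v. of_real (\<omega> k) * c k" and ?b = "\<Sum>k=Suc t..v. c k"
    have "(\<Sum>k=t..v. of_real (\<omega> k) * c k) - of_real (\<omega> t) * (\<Sum>k=t..v. c k)
        = (?a - of_real (\<omega> (Suc t)) * ?b) + of_real (\<omega> (Suc t) - \<omega> t) * ?b"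
      using step by (simp add: sum.atLeast_Suc_atMost algebra_simps)
    also have "norm \<dots> \<le> (\<omega> v - \<omega> (Suc t)) * B + (\<omega> (Suc t) - \<omega> t) * B"
    proof (intro norm_triangle_mono)
      show "norm (?a - of_real (\<omega> (Suc t)) * ?b) \<le> (\<omega> v - \<omega> (Suc t)) * B"
        using step by simp
      show "norm (of_real (\<omega> (Suc t) - \<omega> t) * ?b) \<le> (\<omega> (Suc t) - \<omega> t) * B"
        unfolding norm_mult norm_of_real using step mono[of t] tail[of "Suc t"]
        by (intro mult_mono) auto
    qed
    finally show ?case by (simp add: algebra_simps)
  qed simp
  from this[of u] have 1: "norm ((\<Sum>k=u..v. of_real (\<omega> k) * c k) - of_real (\<omega> u) * (\<Sum>k=u..v. c k)) \<le> (\<omega> v - \<omega> u) * B"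
    using assms by simp
  have 2: "norm (of_real (\<omega> u) * (\<Sum>k=u..v. c k)) \<le> \<omega> u * B"
    unfolding norm_mult norm_of_real using assms tail[of u] by (intro mult_mono) auto
  have "norm (\<Sum>k=u..v. of_real (\<omega> k) * c k) \<le> (\<omega> v - \<omega> u) * B + \<omega> u * B"
    using norm_triangle_mono[OF 1 2] by simp
  thus ?thesis by (simp add: algebra_simps)
qed

lemma norm_sum_ln_e_Li_dilate_le:
  fixes N N2 :: real and h :: int and r :: nat
  defines "L \<equiv> ln N"
  assumes N: "N \<ge> 2" "L \<ge> 1" "N2 \<le> 2 * N"
    and h: "0 < h" "of_int h \<le> L ^ 4"
    and r: "0 < r" "(real r)\<^sup>2 \<le> N"
  shows "norm (\<Sum>l | N < real (r * l) \<and> real (r * l) \<le> N2. of_real (ln (real l)) * e (of_int h * Li (real (r * l))))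
           \<le> 108 * L ^ 6 * sqrt N"
proof -
  define A where "A = {l. N < real (r * l) \<and> real (r * l) \<le> N2}"
  have dil: "real (r * x) \<le> real (r * y)" if "x \<le> y" for x y
    using that by (simp only: of_nat_le_iff mult_le_mono2)
  have conv: "order_convex {l \<in> A. t \<le> l}" for t
    unfolding order_convex_def
  proof safe
    fix x y z assume "x \<in> A" "z \<in> A" "t \<le> x" "y \<in> {x..z}"
    thus "t \<le> y" "y \<in> A" using dil[of x y] dil[of y z] unfolding A_def by auto
  qed
  show ?thesis
  proof (cases "A = {}")
    case True
    thus ?thesis using N unfolding A_def[symmetric] by simp
  next
    case False
    have A_le: "0 < l \<and> real l \<le> 2 * N" if "l \<in> A" for l
    proof -
      have "real l \<le> real (r * l)" using r by (simp only: of_nat_le_iff) simp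
      moreover have "0 < real r * real l" using that N by (auto simp: A_def)
      hence "0 < l" by (auto intro: Nat.gr0I)
      moreover have "real (r * l) \<le> 2 * N" using that N by (simp add: A_def)
      ultimately show ?thesis by linarith
    qed
    have "A \<subseteq> {..nat \<lfloor>2 * N\<rfloor>}" using A_le by (auto intro: le_nat_floor)
    hence "finite A" using finite_subset by blast
    define u v where "u = Min A" and "v = Max A"
    have "order_convex A" using conv[of 0] by simp
    from order_convex_eq_atLeastAtMost[OF \<open>finite A\<close> False this]
    have uv: "A = {u..v}" "u \<in> A" "v \<in> A" "u \<le> v" by (auto simp: u_def v_def)
    have "norm (\<Sum>l=u..v. of_real (ln (real l)) * e (of_int h * Li (real (r * l)))) \<le> ln (real v) * (54 * L ^ 5 * sqrt N)"
    proof (rule norm_sum_weighted_le)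
      fix t assume t: "u \<le> t" "t \<le> v"
      have "{t..v} = {l \<in> A. t \<le> l}" using uv(1) t by auto
      thus "norm (\<Sum>l=t..v. e (of_int h * Li (real (r * l)))) \<le> 54 * L ^ 5 * sqrt N"
        unfolding L_def using conv[of t] N h r
        by (intro norm_sum_e_Li_dilate_le) (auto simp: A_def L_def)
    qed (use uv A_le[of u] in auto)
    also have "\<dots> \<le> (2 * L) * (54 * L ^ 5 * sqrt N)"
    proof (intro mult_right_mono)
      have "ln (real v) \<le> ln (2 * N)" using A_le[OF uv(3)] by simp
      also have "\<dots> \<le> 2 * L" using ln_bounds[of N "2 * N"] N by (auto simp: L_def)
      finally show "ln (real v) \<le> 2 * L" .
    qed (use N in auto)
    also have "\<dots> = 108 * L ^ 6 * sqrt N" by (simp add: eval_nat_numeral)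
    finally show ?thesis using uv(1) unfolding A_def by simp
  qed
qed

text \<open>All dilations in the type I sums are at most U V <= w^8, so their squares stay below
  \<open>N\<close>. There are at most w^8 of them, each costing sqrt N = w^11; the constants add up
  as 108 + 108 + 900 = 1116.\<close>

lemma norm_sum_mangoldt_e_Li_le:
  fixes w N2 :: real and h :: int
  defines "N \<equiv> w ^ 22"
  defines "L \<equiv> ln N"
  assumes w: "w \<ge> 2" and L: "L \<ge> 4" and N2: "N2 \<le> 2 * N"
    and h: "0 < h" "of_int h \<le> L ^ 4"
  shows "norm (\<Sum>n | N < real n \<and> real n \<le> N2. mangoldt n * e (of_int h * Li (real n)))
           \<le> 1200 * L ^ 6 * w ^ 21"
proof -
  define J where "J = {n. N < real n \<and> real n \<le> N2}"
  define E where "E n = e (of_int h * Li (real n))" for n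
  define U V X where "U = nat \<lfloor>w ^ 6\<rfloor>" and "V = nat \<lfloor>w\<^sup>2\<rfloor>" and "X = nat \<lfloor>2 * N\<rfloor>"
  have w1: "w ^ k \<ge> 1" for k using w by (intro one_le_power) auto
  have wmono: "w ^ i \<le> w ^ j" if "i \<le> j" for i j using that w by (intro power_increasing) auto
  have N: "N \<ge> 2"
    using w self_le_power[of w 22] by (auto simp: N_def)
  have V: "1 \<le> V" "real V \<le> w\<^sup>2" and U: "1 \<le> U" "real U \<le> w ^ 6"
    unfolding U_def V_def using nat_floor_ge_half(2)[OF w1[of 2]] nat_floor_ge_half(2)[OF w1[of 6]] w1[of 2] w1[of 6]
    by (auto intro: le_nat_floor)
  have "real U * real V \<le> w ^ 6 * w\<^sup>2" using U V w by (intro mult_mono) auto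
  also have "\<dots> = w ^ 8" by (simp flip: power_add)
  finally have UV: "real U * real V \<le> w ^ 8" .
  have sqrtN: "sqrt N = w ^ 11"
    unfolding N_def using w by (intro real_sqrt_unique) (auto simp flip: power_mult)
  have r_sq: "(real r)\<^sup>2 \<le> N" if "real r \<le> w ^ 8" for r
  proof -
    have "(real r)\<^sup>2 \<le> (w ^ 8)\<^sup>2" using that by (intro power_mono) auto
    also have "\<dots> \<le> N" using wmono[of 16 22] by (simp add: N_def flip: power_mult)
    finally show ?thesis .
  qed
  have J: "J \<subseteq> {U * V<..X}"
  proof
    fix n assume n: "n \<in> J"
    have "real (U * V) < real n" using n UV wmono[of 8 22] by (simp add: J_def N_def)
    hence "U * V < n" by (simp only: of_nat_less_iff)
    moreover have "n \<le> X" using n N2 unfolding X_def J_def by (intro le_nat_floor) auto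
    ultimately show "n \<in> {U * V<..X}" by simp
  qed
  define I1 where "I1 = (\<Sum>d=1..U. of_real (moebius_mu d) * (\<Sum>k | d * k \<in> J. of_real (ln (real k)) * E (d * k)))"
  define I2 where "I2 = (\<Sum>k=1..V. mangoldt k * (\<Sum>d=1..U. of_real (moebius_mu d) * (\<Sum>l | d * l * k \<in> J. E (d * l * k))))"
  define II where "II = (\<Sum>m\<in>{U<..X}. of_real (truncated_moebius_sum U m) * (\<Sum>k | V < k \<and> m * k \<in> J. mangoldt k * E (m * k)))"
  have mu_le: "norm (of_real (moebius_mu d) * z) \<le> norm z" for d and z :: complex
    using mult_right_mono[OF abs_moebius_mu_le_1[of d], of "norm z"] by (simp add: norm_mult)
  have "norm I1 \<le> (\<Sum>d=1..U. 108 * L ^ 6 * sqrt N)"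
    unfolding I1_def
  proof (rule order_trans[OF norm_sum], rule sum_mono)
    fix d assume d: "d \<in> {1..U}"
    have "real d \<le> w ^ 8" using d U wmono[of 6 8] by simp
    hence "norm (\<Sum>k | d * k \<in> J. of_real (ln (real k)) * E (d * k)) \<le> 108 * L ^ 6 * sqrt N"
      using norm_sum_ln_e_Li_dilate_le[of N N2 h d] N L N2 h d r_sq[of d]
      unfolding J_def E_def L_def by auto
    with mu_le show "norm (of_real (moebius_mu d) * (\<Sum>k | d * k \<in> J. of_real (ln (real k)) * E (d * k))) \<le> 108 * L ^ 6 * sqrt N"
      by (rule order_trans)
  qed
  also have "\<dots> = real U * (108 * L ^ 6 * sqrt N)" by simp
  also have "\<dots> \<le> w ^ 8 * (108 * L ^ 6 * sqrt N)"
    using U wmono[of 6 8] L N by (intro mult_right_mono) auto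
  finally have I1: "norm I1 \<le> w ^ 8 * (108 * L ^ 6 * sqrt N)" .
  have "norm I2 \<le> (\<Sum>k=1..V. (2 * L) * (\<Sum>d=1..U. 54 * L ^ 5 * sqrt N))"
    unfolding I2_def
  proof (rule order_trans[OF norm_sum], rule sum_mono)
    fix k assume k: "k \<in> {1..V}"
    have "norm (\<Sum>d=1..U. of_real (moebius_mu d) * (\<Sum>l | d * l * k \<in> J. E (d * l * k)))
        \<le> (\<Sum>d=1..U. 54 * L ^ 5 * sqrt N)"
    proof (rule order_trans[OF norm_sum], rule sum_mono)
      fix d assume d: "d \<in> {1..U}"
      have "real d * real k \<le> real U * real V" using d k by (intro mult_mono) auto
      hence dk: "real (d * k) \<le> w ^ 8" using UV by simp
      define A where "A = {l. d * l * k \<in> J}"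
      have "order_convex A"
        unfolding order_convex_def
      proof safe
        fix x y z assume xz: "x \<in> A" "z \<in> A" "y \<in> {x..z}"
        hence "d * x * k \<le> d * y * k" "d * y * k \<le> d * z * k" by auto
        hence "real (d * x * k) \<le> real (d * y * k)" "real (d * y * k) \<le> real (d * z * k)"
          by (simp_all only: of_nat_le_iff)
        thus "y \<in> A" using xz unfolding A_def J_def by auto
      qed
      hence "norm (\<Sum>l\<in>A. e (of_int h * Li (real (d * k * l)))) \<le> 54 * L ^ 5 * sqrt N"
        unfolding L_def
        by (intro norm_sum_e_Li_dilate_le[where ?N2.0 = N2])
           (use N L N2 h d k r_sq[OF dk] in \<open>auto simp: A_def J_def L_def mult_ac\<close>)
      also have "(\<Sum>l\<in>A. e (of_int h * Li (real (d * k * l)))) = (\<Sum>l | d * l * k \<in> J. E (d * l * k))"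
        by (simp add: A_def E_def mult_ac)
      finally have "norm (\<Sum>l | d * l * k \<in> J. E (d * l * k)) \<le> 54 * L ^ 5 * sqrt N" .
      with mu_le show "norm (of_real (moebius_mu d) * (\<Sum>l | d * l * k \<in> J. E (d * l * k))) \<le> 54 * L ^ 5 * sqrt N"
        by (rule order_trans)
    qed
    moreover have "norm (mangoldt k :: complex) \<le> 2 * L"
    proof -
      have "real k \<le> N" using k V wmono[of 2 22] by (simp add: N_def)
      have "mangoldt k \<le> ln (real k)" using mangoldt_le[of k] k by simp
      also have "\<dots> \<le> L" unfolding L_def using \<open>real k \<le> N\<close> k by simp
      finally show ?thesis using L by simp
    qed
    ultimately show "norm (mangoldt k * (\<Sum>d=1..U. of_real (moebius_mu d) * (\<Sum>l | d * l * k \<in> J. E (d * l * k))))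
        \<le> (2 * L) * (\<Sum>d=1..U. 54 * L ^ 5 * sqrt N)"
      unfolding norm_mult by (intro mult_mono) (use L in auto)
  qed
  also have "\<dots> = (real U * real V) * (108 * L ^ 6 * sqrt N)" by (simp add: eval_nat_numeral)
  also have "\<dots> \<le> w ^ 8 * (108 * L ^ 6 * sqrt N)"
    using UV L N by (intro mult_right_mono) auto
  finally have I2: "norm I2 \<le> w ^ 8 * (108 * L ^ 6 * sqrt N)" .
  have "w ^ 8 * (108 * L ^ 6 * sqrt N) = 108 * L ^ 6 * w ^ 19"
    by (simp add: sqrtN flip: power_add)
  also have "\<dots> \<le> 108 * L ^ 6 * w ^ 21"
    using wmono[of 19 21] L by (intro mult_left_mono) auto
  finally have type_I: "w ^ 8 * (108 * L ^ 6 * sqrt N) \<le> 108 * L ^ 6 * w ^ 21" .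
  have "norm II \<le> (\<Sum>m\<in>{U<..X}. real (card {d. d dvd m}) * norm (\<Sum>k | V < k \<and> m * k \<in> J. mangoldt k * E (m * k)))"
    unfolding II_def
  proof (rule order_trans[OF norm_sum], rule sum_mono)
    fix m assume "m \<in> {U<..X}"
    thus "norm (of_real (truncated_moebius_sum U m) * (\<Sum>k | V < k \<and> m * k \<in> J. mangoldt k * E (m * k)))
        \<le> real (card {d. d dvd m}) * norm (\<Sum>k | V < k \<and> m * k \<in> J. mangoldt k * E (m * k))"
      unfolding norm_mult norm_of_real
      by (intro mult_right_mono abs_truncated_moebius_sum_le) auto
  qed
  also have "\<dots> \<le> 900 * L ^ 6 * w ^ 21"
    using type_II_le[of w N2 h] w L N2 h unfolding J_def E_def U_def V_def X_def L_def N_def by simp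
  finally have II: "norm II \<le> 900 * L ^ 6 * w ^ 21" .
  have "(\<Sum>n\<in>J. mangoldt n * E n) = I1 - I2 - II"
    unfolding I1_def I2_def II_def by (rule Vaughan_identity[OF J U(1)])
  hence "norm (\<Sum>n\<in>J. mangoldt n * E n) \<le> norm I1 + norm I2 + norm II"
    using norm_triangle_ineq4[of "I1 - I2" II] norm_triangle_ineq4[of I1 I2] by simp
  also have "\<dots> \<le> 1116 * L ^ 6 * w ^ 21" using I1 I2 II type_I by simp
  also have "\<dots> \<le> 1200 * L ^ 6 * w ^ 21" using w by simp
  finally show ?thesis by (simp add: J_def E_def)
qed

theorem theorem4p1:
  fixes \<epsilon> :: real
  assumes "\<epsilon> > 0"
  shows "\<exists>C N0 :: real. \<forall>N N2 :: real.
           N0 \<le> N \<and> N < N2 \<and> N2 \<le> 2 * N \<longrightarrow> S N N2 \<le> C * N powr (21 / 22 + \<epsilon>)"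
proof -
  \<comment> \<open>The exponent 10 is 6 from a single exponential sum plus 4 from the number of
    \<open>h\<close>. The threshold involves only \<open>N\<close>, so the bound is uniform in
    \<open>N2\<close>.\<close>
  have "eventually (\<lambda>N::real. ln N ^ 10 \<le> N powr \<epsilon>) at_top"
    using assms by real_asymp
  moreover have "eventually (\<lambda>N::real. 4 \<le> ln N) at_top" by real_asymp
  moreover have "eventually (\<lambda>N::real. 2 \<le> N powr (1 / 22)) at_top" by real_asymp
  ultimately have "eventually (\<lambda>N::real. ln N ^ 10 \<le> N powr \<epsilon> \<and> 4 \<le> ln N \<and> 2 \<le> N powr (1 / 22) \<and> 1 \<le> N) at_top"
    using eventually_ge_at_top[of "1::real"] by eventually_elim auto
  then obtain N0 :: real where N0:
    "\<And>N. N0 \<le> N \<Longrightarrow> ln N ^ 10 \<le> N powr \<epsilon> \<and> 4 \<le> ln N \<and> 2 \<le> N powr (1 / 22) \<and> 1 \<le> N"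
    unfolding eventually_at_top_linorder by blast
  have "S N N2 \<le> 1200 * N powr (21 / 22 + \<epsilon>)" if "N0 \<le> N" "N2 \<le> 2 * N" for N N2
  proof -
    define w where "w = N powr (1 / 22)"
    define L where "L = ln N"
    have N: "L ^ 10 \<le> N powr \<epsilon>" "4 \<le> L" "2 \<le> w" "1 \<le> N"
      using N0[OF that(1)] by (auto simp: w_def L_def)
    have w22: "N = w ^ 22" and w21: "w ^ 21 = N powr (21 / 22)"
      using N(4) by (auto simp: w_def powr_power)
    define Hs where "Hs = {h::int. 0 < h \<and> of_int h \<le> L ^ 4}"
    have "Hs = {1..\<lfloor>L ^ 4\<rfloor>}" by (auto simp: Hs_def le_floor_iff)
    hence "real (card Hs) = of_int \<lfloor>L ^ 4\<rfloor>" using N(2) by simp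
    hence card: "real (card Hs) \<le> L ^ 4" by linarith
    have "S N N2 \<le> (\<Sum>h\<in>Hs. 1200 * L ^ 6 * w ^ 21)"
      unfolding S_def Hs_def[unfolded L_def, symmetric]
    proof (rule sum_mono)
      fix h assume "h \<in> Hs"
      thus "norm (\<Sum>n | N < real n \<and> real n \<le> N2. mangoldt n * e (of_int h * Li (real n))) \<le> 1200 * L ^ 6 * w ^ 21"
        using norm_sum_mangoldt_e_Li_le[of w N2 h] N that w22 by (simp add: Hs_def L_def)
    qed
    also have "\<dots> = real (card Hs) * (1200 * L ^ 6 * w ^ 21)" by simp
    also have "\<dots> \<le> L ^ 4 * (1200 * L ^ 6 * w ^ 21)"
      using card N by (intro mult_right_mono) auto
    also have "\<dots> = 1200 * (w ^ 21 * L ^ 10)" by (simp add: eval_nat_numeral)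
    also have "\<dots> \<le> 1200 * (w ^ 21 * N powr \<epsilon>)"
      using N by (intro mult_left_mono) auto
    also have "\<dots> = 1200 * N powr (21 / 22 + \<epsilon>)" by (simp add: w21 powr_add)
    finally show ?thesis .
  qed
  thus ?thesis by blast
qed

end
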